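(* Let $\Sigma\subset N_{\mathbb R}$ be a closed strictly convex cone with boundary rays $R_1$ and $R_2$ (non-parallel, emanating from the origin) such that $R_1$ has a rational slope. Then $$ta(R_1R_2)=\cfrac{1}{w_1+\cfrac{1}{s_1+\cfrac{1}{w_2+\cfrac{1}{s_2+\cdots}}}}\pmod 1,$$ where $w_1,w_2,\dots$ is the sequence of weights of the rays $W_1,W_2,\dots$ of the tropical caustic $\mathcal K_\Sigma$, listed in the natural order starting from the one closest to $R_1$, and $s_j$ is the length gradient of the edge $E_j(t)$ of the tropical wave front $\partial\Sigma(t)$ connecting $W_j$ and $W_{j+1}$. (The continued fraction is finite, ending with the last weight, if the caustic has finitely many rays, and infinite otherwise.)
   Context: $N\cong\mathbb Z^2$ is a rank two lattice, $N_{\mathbb R}=N\otimes\mathbb R$, $M=\operatorname{Hom}(N,\mathbb Z)$. A ray has rational slope if it is parallel to a nonzero vector of $N$. Tropical cotangent: let $e_1\in N$ be the primitive vector generating $R_1$, and let $e_2\in N$ be a vector such that $(e_1,e_2)$ is a basis of $N$ and $R_2$ contains a point of the form $e_2+se_1$ with $s\in\mathbb R$. The vector $e_2$ is well defined up to adding integer multiples of $e_1$, so $s$ is well defined mod 1; put $ta(R_1R_2)=-s\in\mathbb R/\mathbb Z$. Wave front of the cone: for $t\ge0$, $\Sigma(t)=\{p\in N_{\mathbb R}:\lambda(p)\ge t\text{ for every primitive }\lambda\in M\text{ with }\lambda\ge0\text{ on }\Sigma\}$. For $t>0$ it is a polygonal domain with rational slope sides. The caustic $\mathcal K_\Sigma$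 is the locus of all vertices of $\Sigma(t)$, $t>0$; it is a (possibly infinite) union of open rays emanating from the origin, each ray being traced by one vertex. The weight of a ray is $|v\wedge w|$ (absolute value of the determinant in a basis of $N$), where $v,w\in N$ are primitive vectors parallel to the two sides of $\Sigma(t)$ adjacent to the corresponding vertex. The tropical length of an interval parallel to a primitive vector $u\in N$ is the number $\ell\ge0$ such that the difference of its endpoints is $\pm\ell u$. The length gradient of a bounded edge $E(t)$ of $\partial\Sigma(t)$ is the derivative with respect to $t$ of its tropical length. *)

theory Defs
  imports "HOL-Analysis.Analysis"
begin

text \<open>The plane \<open>N\<^sub>\<real>\<close> is \<^typ>\<open>real^2\<close>, and \<open>N\<close> is an arbitrary lattice in it,
  not necessarily the standard one.\<close>

definition lattice_basis :: "(real^2) set \<Rightarrow> real^2 \<Rightarrow> real^2 \<Rightarrow> bool" where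
  "lattice_basis N b1 b2 \<longleftrightarrow> b1 \<noteq> b2 \<and> independent {b1, b2} \<and>
     N = {of_int m *\<^sub>R b1 + of_int n *\<^sub>R b2 | m n :: int. True}"

definition rank_two_lattice :: "(real^2) set \<Rightarrow> bool" where
  "rank_two_lattice N \<longleftrightarrow> (\<exists>b1 b2. lattice_basis N b1 b2)"

definition primitive_vector :: "(real^2) set \<Rightarrow> real^2 \<Rightarrow> bool" where
  "primitive_vector N v \<longleftrightarrow> v \<in> N \<and> v \<noteq> 0 \<and>
     (\<forall>u\<in>N. \<forall>k::int. v = of_int k *\<^sub>R u \<longrightarrow> \<bar>k\<bar> = 1)"

text \<open>\<open>M = Hom(N, \<int>)\<close>, each homomorphism being extended linearly to \<open>N\<^sub>\<real>\<close>.\<close>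

definition dual_lattice :: "(real^2) set \<Rightarrow> (real^2 \<Rightarrow> real) set" where
  "dual_lattice N = {l. linear l \<and> (\<forall>v\<in>N. l v \<in> \<int>)}"

definition primitive_functional :: "(real^2) set \<Rightarrow> (real^2 \<Rightarrow> real) \<Rightarrow> bool" where
  "primitive_functional N l \<longleftrightarrow> l \<in> dual_lattice N \<and> l \<noteq> (\<lambda>_. 0) \<and>
     (\<forall>m\<in>dual_lattice N. \<forall>k::int. l = (\<lambda>x. of_int k * m x) \<longrightarrow> \<bar>k\<bar> = 1)"

text \<open>\<open>|v \<and> w|\<close>; it does not depend on the chosen basis of \<open>N\<close>.\<close>

definition abs_wedge :: "(real^2) set \<Rightarrow> real^2 \<Rightarrow> real^2 \<Rightarrow> real" where
  "abs_wedge N v w = (THE d. \<exists>b1 b2 p q r s. lattice_basis N b1 b2 \<and>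
     v = p *\<^sub>R b1 + q *\<^sub>R b2 \<and> w = r *\<^sub>R b1 + s *\<^sub>R b2 \<and> d = \<bar>p * s - q * r\<bar>)"

definition ray :: "real^2 \<Rightarrow> (real^2) set" where
  "ray v = {c *\<^sub>R v | c. 0 \<le> c}"

definition open_ray :: "real^2 \<Rightarrow> (real^2) set" where
  "open_ray v = {c *\<^sub>R v | c. 0 < c}"

definition parallel_to :: "real^2 \<Rightarrow> (real^2) set \<Rightarrow> bool" where
  "parallel_to v A \<longleftrightarrow> v \<noteq> 0 \<and> (\<forall>a\<in>A. \<forall>b\<in>A. \<exists>c. b - a = c *\<^sub>R v)"

definition rational_slope :: "(real^2) set \<Rightarrow> (real^2) set \<Rightarrow> bool" where
  "rational_slope N A \<longleftrightarrow> (\<exists>v\<in>N. v \<noteq> 0 \<and> parallel_to v A)"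

text \<open>A closed strictly convex (pointed) cone whose boundary consists of two non-parallel
  rays.\<close>

definition cone_with_boundary_rays :: "(real^2) set \<Rightarrow> (real^2) set \<Rightarrow> (real^2) set \<Rightarrow> bool" where
  "cone_with_boundary_rays C R1 R2 \<longleftrightarrow>
     closed C \<and> convex_cone C \<and> C \<inter> uminus ` C = {0} \<and>
     (\<exists>r. r \<noteq> 0 \<and> R1 = ray r) \<and> (\<exists>r. r \<noteq> 0 \<and> R2 = ray r) \<and>
     \<not> (\<exists>v. parallel_to v R1 \<and> parallel_to v R2) \<and>
     frontier C = R1 \<union> R2"

text \<open>Elements of \<open>\<real>/\<int>\<close> are represented as cosets of \<open>\<int>\<close> in \<open>\<real>\<close>.\<close>

definition mod_Z :: "real \<Rightarrow> real set" where
  "mod_Z x = {x + of_int k | k :: int. True}"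

definition tropical_cotangent :: "(real^2) set \<Rightarrow> (real^2) set \<Rightarrow> (real^2) set \<Rightarrow> real set" where
  "tropical_cotangent N R1 R2 = (THE T. \<exists>e1 e2 s.
     primitive_vector N e1 \<and> R1 = ray e1 \<and>
     lattice_basis N e1 e2 \<and> e2 + s *\<^sub>R e1 \<in> R2 \<and> T = mod_Z (- s))"

definition wave_front :: "(real^2) set \<Rightarrow> (real^2) set \<Rightarrow> real \<Rightarrow> (real^2) set" where
  "wave_front N C t = {p. \<forall>l. primitive_functional N l \<and> (\<forall>q\<in>C. 0 \<le> l q) \<longrightarrow> t \<le> l p}"

text \<open>The vertices and the sides of the polygonal domain \<open>wave_front N C t\<close> are its extreme points
  and its one-dimensional faces (\<open>edge_of\<close>; bounded or not).\<close>

definition caustic :: "(real^2) set \<Rightarrow> (real^2) set \<Rightarrow> (real^2) set" where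
  "caustic N C = {p. \<exists>t>0. p extreme_point_of wave_front N C t}"

definition caustic_rays :: "(real^2) set \<Rightarrow> (real^2) set \<Rightarrow> (real^2) set set" where
  "caustic_rays N C = {W. W \<subseteq> caustic N C \<and> (\<exists>v. v \<noteq> 0 \<and> W = open_ray v)}"

definition ray_weight :: "(real^2) set \<Rightarrow> (real^2) set \<Rightarrow> (real^2) set \<Rightarrow> real" where
  "ray_weight N C W = (THE m. \<exists>t>0. \<exists>p\<in>W. \<exists>E F v w.
     p extreme_point_of wave_front N C t \<and>
     E edge_of wave_front N C t \<and> F edge_of wave_front N C t \<and> E \<noteq> F \<and> p \<in> E \<and> p \<in> F \<and>
     primitive_vector N v \<and> parallel_to v E \<and>
     primitive_vector N w \<and> parallel_to w F \<and>
     m = abs_wedge N v w)"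

definition tropical_length :: "(real^2) set \<Rightarrow> (real^2) set \<Rightarrow> real" where
  "tropical_length N E = (THE len. 0 \<le> len \<and> (\<exists>a b u. E = closed_segment a b \<and>
     primitive_vector N u \<and> (b - a = len *\<^sub>R u \<or> b - a = - (len *\<^sub>R u))))"

text \<open>The bounded edge at time \<open>t\<close> connecting the vertices that trace the rays \<open>W\<close> and \<open>W'\<close>.\<close>

definition connecting_edge ::
  "(real^2) set \<Rightarrow> (real^2) set \<Rightarrow> (real^2) set \<Rightarrow> (real^2) set \<Rightarrow> real \<Rightarrow> (real^2) set" where
  "connecting_edge N C W W' t = (THE E. E edge_of wave_front N C t \<and>
     (\<exists>p\<in>W. \<exists>q\<in>W'. E = closed_segment p q))"

text \<open>The tropical length of the edge is linear in \<open>t\<close>, so its derivative does not depend on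
  \<open>t > 0\<close>.\<close>

definition length_gradient ::
  "(real^2) set \<Rightarrow> (real^2) set \<Rightarrow> (real^2) set \<Rightarrow> (real^2) set \<Rightarrow> real" where
  "length_gradient N C W W' = (THE g. \<forall>t>0.
     ((\<lambda>\<tau>. tropical_length N (connecting_edge N C W W' \<tau>)) has_real_derivative g) (at t))"

text \<open>\<open>W\<close> is closer to \<open>R1\<close> than \<open>W'\<close>: it lies in the sector spanned by \<open>R1\<close> and \<open>W'\<close>, which is
  their convex hull because the origin belongs to \<open>R1\<close>.\<close>

definition closer_to :: "(real^2) set \<Rightarrow> (real^2) set \<Rightarrow> (real^2) set \<Rightarrow> bool" where
  "closer_to R1 W W' \<longleftrightarrow> W \<noteq> W' \<and> W \<subseteq> convex hull (R1 \<union> W')"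

text \<open>\<open>W 0, W 1, \<dots>\<close> lists all elements of \<open>\<K>\<close>, each once, in the order of increasing distance from
  \<open>R1\<close>. If \<open>\<K>\<close> is finite, the values \<open>W j\<close> with \<open>j \<ge> card \<K>\<close> are irrelevant.\<close>

definition natural_listing ::
  "(real^2) set \<Rightarrow> (real^2) set set \<Rightarrow> (nat \<Rightarrow> (real^2) set) \<Rightarrow> bool" where
  "natural_listing R1 \<K> W \<longleftrightarrow>
     (let I = (if finite \<K> then {..<card \<K>} else UNIV) in
        bij_betw W I \<K> \<and> (\<forall>i\<in>I. \<forall>j\<in>I. i < j \<longrightarrow> closer_to R1 (W i) (W j)))"

text \<open>\<open>1/(a\<^sub>0 + 1/(a\<^sub>1 + \<dots> + 1/a\<^sub>k))\<close>\<close>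

fun cont_frac :: "real list \<Rightarrow> real" where
  "cont_frac [] = 0"
| "cont_frac (a # as) = 1 / (a + cont_frac as)"

text \<open>The sequence \<open>w 0, s 0, w 1, s 1, \<dots>\<close>\<close>

definition interleave :: "(nat \<Rightarrow> real) \<Rightarrow> (nat \<Rightarrow> real) \<Rightarrow> nat \<Rightarrow> real" where
  "interleave w s k = (if even k then w (k div 2) else s (k div 2))"

end

theory Submission
  imports Defs
begin

text \<open>Choose a basis \<open>e1, e2\<close> of \<open>N\<close> with \<open>R1 = ray e1\<close> and \<open>R2 = ray (e2 - \<alpha> e1)\<close>, \<open>0 < \<alpha> \<le> 1\<close>; then
  \<open>\<alpha>\<close> represents the tropical cotangent. Starting with \<open>(q, p) = (e1, e2)\<close>, alternately replace \<open>q\<close> by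
  \<open>q - w p\<close> and \<open>p\<close> by \<open>p - s q\<close>, where \<open>w\<close> is the largest integer for which the new \<open>q\<close> does not cross
  \<open>R2\<close> and \<open>s\<close> is the largest integer for which the new \<open>p\<close> stays in the interior of the cone. This is the
  Euclidean algorithm for \<open>\<alpha>\<close>, so \<open>w\<close> and \<open>s\<close> are alternately its partial quotients.

  All pairs \<open>(q, p)\<close> are bases of \<open>N\<close>. The functional \<open>q \<and> _\<close> is primitive and non-negative on the cone,
  and each \<open>p\<close> is an interior lattice point, on which such functionals are at least 1; hence the
  points \<open>t p\<close> are vertices of the wave front at time \<open>t\<close>, with adjacent sides parallel to two successive
  \<open>q\<close>'s. The sectors between successive \<open>p\<close>'s exhaust the interior of the cone, so there are no other
  vertices. The weight is \<open>|q \<and> (q - w p)| = w\<close>, and the edge from \<open>t p\<close> to \<open>t (p - s q)\<close> has length \<open>t s\<close>.\<close>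

section \<open>Area form and lattice bases\<close>

definition cross2 :: "real^2 \<Rightarrow> real^2 \<Rightarrow> real" where
  "cross2 u v = u $ 1 * v $ 2 - u $ 2 * v $ 1"

lemma vec2_eq_iff: "(u::real^2) = v \<longleftrightarrow> u $ 1 = v $ 1 \<and> u $ 2 = v $ 2"
  by (simp add: vec_eq_iff forall_2)

lemma cross2_eq_0_imp_scaled:
  assumes "cross2 u f = 0" "f \<noteq> 0"
  shows "\<exists>c. u = c *\<^sub>R f"
proof -
  have "u = (u $ 1 / f $ 1) *\<^sub>R f" if "f $ 1 \<noteq> 0"
    using assms that by (auto simp: cross2_def vec2_eq_iff field_simps)
  moreover have "u = (u $ 2 / f $ 2) *\<^sub>R f" if "f $ 2 \<noteq> 0"
    using assms that by (auto simp: cross2_def vec2_eq_iff field_simps)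
  ultimately show ?thesis
    using assms(2) by (metis vec2_eq_iff zero_index)
qed

lemma independent_iff_cross2:
  "u \<noteq> v \<and> independent {u, v} \<longleftrightarrow> cross2 u v \<noteq> 0"
proof
  assume h: "u \<noteq> v \<and> independent {u, v}"
  show "cross2 u v \<noteq> 0"
  proof
    assume 0: "cross2 u v = 0"
    have ne: "v \<noteq> 0" "u \<notin> span {v}"
      using h by (auto simp: independent_insert)
    then show False
      using cross2_eq_0_imp_scaled[OF 0] by (auto simp: span_singleton)
  qed
next
  assume h: "cross2 u v \<noteq> 0"
  have "v \<noteq> 0"
    using h by (auto simp: cross2_def)
  moreover have "u \<noteq> k *\<^sub>R v" for k
    using h by (auto simp: cross2_def)
  moreover from this[of 1] have "u \<noteq> v"
    by simp
  ultimately show "u \<noteq> v \<and> independent {u, v}"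
    by (auto simp: independent_insert span_singleton)
qed

lemma lattice_basis_iff:
  "lattice_basis N b1 b2 \<longleftrightarrow> cross2 b1 b2 \<noteq> 0 \<and>
     N = {of_int m *\<^sub>R b1 + of_int n *\<^sub>R b2 | m n :: int. True}"
  unfolding lattice_basis_def using independent_iff_cross2 by blast

lemma lattice_basis_change:
  fixes a b c d :: int
  assumes "lattice_basis N b1 b2" "\<bar>a * d - b * c\<bar> = 1"
    "c1 = of_int a *\<^sub>R b1 + of_int b *\<^sub>R b2" "c2 = of_int c *\<^sub>R b1 + of_int d *\<^sub>R b2"
  shows "lattice_basis N c1 c2"
proof -
  define \<epsilon> where "\<epsilon> = a * d - b * c"
  have \<epsilon>: "\<epsilon> * \<epsilon> = 1" "\<epsilon> \<noteq> 0"
    using assms(2) unfolding \<epsilon>_def[symmetric] by (auto simp: abs_if split: if_splits)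
  have "cross2 c1 c2 = of_int \<epsilon> * cross2 b1 b2"
    by (simp add: assms \<epsilon>_def cross2_def algebra_simps)
  then have "cross2 c1 c2 \<noteq> 0"
    using assms(1) \<epsilon> by (simp add: lattice_basis_iff)
  moreover have "N = {of_int m *\<^sub>R c1 + of_int n *\<^sub>R c2 | m n :: int. True}" (is "_ = ?R")
  proof
    have N: "N = {of_int m *\<^sub>R b1 + of_int n *\<^sub>R b2 | m n :: int. True}"
      using assms(1) by (simp add: lattice_basis_iff)
    show "N \<subseteq> ?R"
    proof
      fix x assume "x \<in> N"
      then obtain m n :: int where x: "x = of_int m *\<^sub>R b1 + of_int n *\<^sub>R b2"
        using N by blast
      have e: "real_of_int \<epsilon> * real_of_int \<epsilon> = 1"
        using \<epsilon>(1) by (metis of_int_1 of_int_mult)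
      have e2: "real_of_int \<epsilon> = a * d - b * c"
        by (simp add: \<epsilon>_def)
      \<comment> \<open>Cramer's rule: the determinant \<open>\<epsilon>\<close> is its own inverse,
        so the coordinates of \<open>x\<close> in the new basis are again integers.\<close>
      have "x = (of_int \<epsilon> * of_int \<epsilon>) *\<^sub>R x"
        using e by simp
      also have "\<dots> = of_int (\<epsilon> * (m * d - n * c)) *\<^sub>R c1 + of_int (\<epsilon> * (n * a - m * b)) *\<^sub>R c2"
        by (simp add: x assms(3,4) e2 algebra_simps vec2_eq_iff)
      finally show "x \<in> ?R"
        by blast
    qed
    show "?R \<subseteq> N"
    proof
      fix x assume "x \<in> ?R"
      then obtain m n :: int where x: "x = of_int m *\<^sub>R c1 + of_int n *\<^sub>R c2"
        by blast
      have "x = of_int (m * a + n * c) *\<^sub>R b1 + of_int (m * b + n * d) *\<^sub>R b2"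
        by (simp add: x assms(3,4) algebra_simps)
      then show "x \<in> N"
        using N by blast
    qed
  qed
  ultimately show ?thesis
    by (simp add: lattice_basis_iff)
qed

section \<open>Continued fractions\<close>

text \<open>The \<open>foldr\<close> form leaves the innermost value free. A number can thus be
  written exactly as a finite continued fraction with a tail, and its convergent is the same
  expression with tail 0.\<close>

lemma foldr_cont_frac: "cont_frac as = foldr (\<lambda>a x. 1 / (a + x)) as 0"
  by (induction as) simp_all

lemma foldr_cont_frac_nonneg:
  assumes "\<And>a. a \<in> set as \<Longrightarrow> 1 \<le> a" "0 \<le> (x::real)"
  shows "0 \<le> foldr (\<lambda>a x. 1 / (a + x)) as x"
  using assms by (induction as) (auto intro!: divide_nonneg_nonneg add_nonneg_nonneg intro: order_trans[of 0 1])

text \<open>One step \<open>1 / (a + x)\<close> need not contract, since its slope may be -1 at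
  \<open>a = 1\<close>, \<open>x = 0\<close>, but two successive steps shrink distances at least
  fourfold. Hence the induction by two entries, and the factor 2 that absorbs an odd length.\<close>

lemma foldr_cont_frac_contraction:
  assumes "\<And>a. a \<in> set as \<Longrightarrow> 1 \<le> a" "0 \<le> (x::real)" "0 \<le> y"
  shows "\<bar>foldr (\<lambda>a x. 1 / (a + x)) as x - foldr (\<lambda>a x. 1 / (a + x)) as y\<bar>
    \<le> 2 * (1 / 2) ^ length as * \<bar>x - y\<bar>"
  using assms(1)
proof (induction as rule: induct_list012)
  case 1
  then show ?case by simp
next
  case (2 a)
  have a: "1 \<le> a" using 2 by simp
  have pos: "1 \<le> (a + x) * (a + y)"
    using mult_mono[of 1 "a + x" 1 "a + y"] a assms(2,3) by simp
  have "1 / (a + x) - 1 / (a + y) = (y - x) / ((a + x) * (a + y))"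
    using a assms(2,3) by (simp add: field_simps)
  then have "\<bar>1 / (a + x) - 1 / (a + y)\<bar> = \<bar>x - y\<bar> / ((a + x) * (a + y))"
    using pos by (simp add: abs_div abs_minus_commute del: mult_eq_0_iff)
  also have "\<dots> \<le> \<bar>x - y\<bar> / 1"
    using pos by (intro divide_left_mono) auto
  finally show ?case by simp
next
  case (3 a b cs)
  define u where "u = foldr (\<lambda>a x. 1 / (a + x)) cs x"
  define v where "v = foldr (\<lambda>a x. 1 / (a + x)) cs y"
  have ab: "1 \<le> a" "1 \<le> b" using 3 by auto
  have uv: "0 \<le> u" "0 \<le> v"
    unfolding u_def v_def using 3 assms by (auto intro!: foldr_cont_frac_nonneg)
  have IH: "\<bar>u - v\<bar> \<le> 2 * (1 / 2) ^ length cs * \<bar>x - y\<bar>"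
    unfolding u_def v_def by (rule 3(1)) (use 3 in auto)
  \<comment> \<open>Two steps form a Moebius transformation of determinant 1, so a difference of two
    values is \<open>u - v\<close> divided by the product of the denominators, each at least
    2.\<close>
  have f: "1 / (a + 1 / (b + z)) = (b + z) / (a * (b + z) + 1)" "2 \<le> a * (b + z) + 1" if "0 \<le> z" for z
  proof -
    have "1 \<le> a * (b + z)"
      using mult_mono[of 1 a 1 "b + z"] ab that by simp
    then show "2 \<le> a * (b + z) + 1" by simp
    then show "1 / (a + 1 / (b + z)) = (b + z) / (a * (b + z) + 1)"
      using ab that by (simp add: field_simps)
  qed
  have pos: "4 \<le> (a * (b + u) + 1) * (a * (b + v) + 1)"
    using mult_mono[OF f(2)[OF uv(1)] f(2)[OF uv(2)]] f(2)[OF uv(1)] by simp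
  have "1 / (a + 1 / (b + u)) - 1 / (a + 1 / (b + v)) =
      (u - v) / ((a * (b + u) + 1) * (a * (b + v) + 1))"
    unfolding f(1)[OF uv(1)] f(1)[OF uv(2)] using f(2)[OF uv(1)] f(2)[OF uv(2)]
    by (simp add: divide_simps) (simp add: algebra_simps)
  then have "\<bar>1 / (a + 1 / (b + u)) - 1 / (a + 1 / (b + v))\<bar> =
      \<bar>u - v\<bar> / ((a * (b + u) + 1) * (a * (b + v) + 1))"
    using pos by (simp only: abs_divide)
  also have "\<dots> \<le> \<bar>u - v\<bar> / 4"
    using pos by (intro divide_left_mono) auto
  also have "\<dots> \<le> 2 * (1 / 2) ^ length (a # b # cs) * \<bar>x - y\<bar>"
    using IH by simp
  finally show ?case
    by (simp add: u_def v_def)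
qed

section \<open>Convex geometry of the plane\<close>

lemma cross2_plucker:
  "cross2 u v *\<^sub>R w + cross2 v w *\<^sub>R u + cross2 w u *\<^sub>R v = 0"
  by (simp add: cross2_def vec2_eq_iff algebra_simps)

text \<open>When \<open>l\<close> is applied to the relation between \<open>u\<close>,
  \<open>f\<close> and \<open>g\<close>, only the term with \<open>l g\<close> survives, so
  \<open>cross2 u f\<close> vanishes.\<close>

lemma kernel_one_dimensional:
  fixes l :: "real^2 \<Rightarrow> real"
  assumes "linear l" "l u = 0" "l f = 0" "f \<noteq> 0" "l g \<noteq> 0"
  shows "\<exists>c. u = c *\<^sub>R f"
proof (rule cross2_eq_0_imp_scaled[OF _ assms(4)])
  have "l (cross2 f g *\<^sub>R u + cross2 g u *\<^sub>R f + cross2 u f *\<^sub>R g) = 0"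
    using assms(1) by (simp add: cross2_plucker linear_0)
  then show "cross2 u f = 0"
    using assms by (simp add: linear_add linear_scale)
qed

text \<open>At a point of minimum inside a segment, the non-negative excesses at the endpoints have
  a vanishing combination with positive weights, so both are zero.\<close>

lemma face_of_linear_min:
  fixes l :: "'a::real_vector \<Rightarrow> real"
  assumes "convex S" "linear l" "\<And>x. x \<in> S \<Longrightarrow> t \<le> l x"
  shows "S \<inter> {x. l x = t} face_of S"
  unfolding face_of_def
proof (intro conjI ballI impI)
  show "S \<inter> {x. l x = t} \<subseteq> S"
    by blast
  have "S \<inter> {x. l x = t} = S \<inter> l -` {t}"
    by auto
  then show "convex (S \<inter> {x. l x = t})"
    using assms by (simp add: convex_Int convex_linear_vimage)
  fix a b x assume h: "a \<in> S" "b \<in> S" "x \<in> S \<inter> {x. l x = t}" "x \<in> open_segment a b"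
  then obtain u where u: "0 < u" "u < 1" "x = (1 - u) *\<^sub>R a + u *\<^sub>R b"
    by (auto simp: in_segment)
  have "l x = (1 - u) * l a + u * l b"
    using assms(2) by (simp add: u(3) linear_add linear_scale)
  then have eq: "(1 - u) * (l a - t) + u * (l b - t) = 0"
    using h(3) by (simp add: algebra_simps)
  have "0 \<le> l a - t" "0 \<le> l b - t"
    using assms(3) h by auto
  then have "(1 - u) * (l a - t) = 0 \<and> u * (l b - t) = 0"
    using eq u by (subst (asm) add_nonneg_eq_0_iff) auto
  then show "a \<in> S \<inter> {x. l x = t}" "b \<in> S \<inter> {x. l x = t}"
    using u h by auto
qed

text \<open>The intersection is a face of both edges and contains a line segment. A proper face of
  an edge would have smaller dimension.\<close>

lemma edges_eqI:
  fixes S :: "'a::euclidean_space set"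
  assumes "E edge_of S" "F edge_of S" "x \<in> E \<inter> F" "y \<in> E \<inter> F" "x \<noteq> y"
  shows "E = F"
proof -
  have EF: "E face_of S" "F face_of S" "aff_dim E = 1" "aff_dim F = 1"
    using assms by (auto simp: edge_of_def)
  have "aff_dim {x, y} \<le> aff_dim (E \<inter> F)"
    using assms by (intro aff_dim_subset) auto
  then have dim: "\<not> aff_dim (E \<inter> F) < 1"
    using assms(5) by simp
  have faces: "E \<inter> F face_of E" "E \<inter> F face_of F"
    using EF by (auto intro: face_of_subset[OF face_of_Int[OF EF(1,2)]] dest: face_of_imp_subset)
  have "E \<inter> F = E"
    using face_of_aff_dim_lt[OF face_of_imp_convex[OF EF(1)] faces(1)] dim EF(3) by argo
  moreover have "E \<inter> F = F"
    using face_of_aff_dim_lt[OF face_of_imp_convex[OF EF(2)] faces(2)] dim EF(4) by argo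
  ultimately show ?thesis by simp
qed

lemma extreme_point_direction_0:
  assumes "x extreme_point_of S" "x - d \<in> S" "x + d \<in> S"
  shows "d = 0"
proof (rule ccontr)
  assume "d \<noteq> 0"
  have "(x + d) - (x - d) = 2 *\<^sub>R d"
    by (simp add: scaleR_2)
  with \<open>d \<noteq> 0\<close> have "x - d \<noteq> x + d"
    by (metis diff_self scale_eq_0_iff zero_neq_numeral)
  moreover have "midpoint (x - d) (x + d) = x"
    by (simp add: midpoint_eq_iff)
  ultimately have "x \<in> open_segment (x - d) (x + d)"
    by (metis midpoint_in_open_segment)
  then show False
    using assms by (auto simp: extreme_point_of_def)
qed

section \<open>Corners of a planar convex set: \<open>v\<close> is where two supporting lines meet,
  \<open>y\<close> and \<open>z\<close> are further points on them\<close>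

context
  fixes S :: "(real^2) set" and l m :: "real^2 \<Rightarrow> real" and t :: real and v y z :: "real^2"
  assumes S: "convex S" and l: "linear l" and m: "linear m"
    and ge: "\<And>x. x \<in> S \<Longrightarrow> t \<le> l x" "\<And>x. x \<in> S \<Longrightarrow> t \<le> m x"
    and v: "v \<in> S" "l v = t" "m v = t"
    and y: "y \<in> S" "l y = t" "t < m y"
    and z: "z \<in> S" "m z = t" "t < l z"
begin

lemma corner_directions:
  "l (y - v) = 0" "l (z - v) \<noteq> 0" "m (y - v) \<noteq> 0" "y - v \<noteq> 0"
  using l m v y z by (auto simp: linear_diff)

lemma edge_at_corner: "S \<inter> {x. l x = t} edge_of S"
  unfolding edge_of_def
proof
  show "S \<inter> {x. l x = t} face_of S"
    using S l ge(1) by (rule face_of_linear_min)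
  have "\<exists>c. x - v = c *\<^sub>R (y - v)" if "l x = t" for x
    using that l v by (intro kernel_one_dimensional[OF l _ corner_directions(1,4,2)]) (simp add: linear_diff)
  then have "S \<inter> {x. l x = t} \<subseteq> affine hull {v, y}"
    by (fastforce simp: affine_hull_2_alt algebra_simps)
  then have "aff_dim (S \<inter> {x. l x = t}) \<le> aff_dim {v, y}"
    by (metis aff_dim_affine_hull aff_dim_subset)
  moreover have "aff_dim {v, y} \<le> aff_dim (S \<inter> {x. l x = t})"
    using v y by (intro aff_dim_subset) auto
  moreover have "v \<noteq> y"
    using corner_directions(4) by simp
  ultimately show "aff_dim (S \<inter> {x. l x = t}) = 1"
    by simp
qed

lemma extreme_point_at_corner: "v extreme_point_of S"
proof -
  have "x = v" if "l x = t" "m x = t" for x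
  proof -
    have "l (x - v) = 0"
      using that l v by (simp add: linear_diff)
    then obtain c where c: "x - v = c *\<^sub>R (y - v)"
      using kernel_one_dimensional[OF l _ corner_directions(1,4,2)] by blast
    have "m (x - v) = 0"
      using that v m by (simp add: linear_diff)
    then have "c * m (y - v) = 0"
      unfolding c linear_scale[OF m] by simp
    then have "c = 0"
      using corner_directions(3) by simp
    with c show ?thesis
      by simp
  qed
  then have "(S \<inter> {x. l x = t}) \<inter> (S \<inter> {x. m x = t}) = {v}"
    using v by blast
  moreover have "(S \<inter> {x. l x = t}) \<inter> (S \<inter> {x. m x = t}) face_of S"
    by (intro face_of_Int face_of_linear_min S l m ge)
  ultimately show ?thesis
    by (simp add: face_of_singleton)
qed

text \<open>Suppose \<open>E\<close> contains a point \<open>x\<close> strictly above both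
  supporting lines. Then \<open>x - v\<close> is a positive combination of the directions to
  \<open>y\<close> and \<open>z\<close>; a point of \<open>E\<close> near \<open>v\<close> lies
  inside a segment joining the two sides, and the face property pulls the endpoint on the side of
  \<open>y\<close> into \<open>E\<close>.\<close>

lemma edge_at_corner_meets:
  assumes E: "E edge_of S" "v \<in> E"
  shows "\<exists>x\<in>E. x \<noteq> v \<and> (l x = t \<or> m x = t)"
proof -
  have face: "E face_of S" and "aff_dim E = 1"
    using E by (auto simp: edge_of_def)
  then have "E \<noteq> {v}"
    by auto
  then obtain x where x: "x \<in> E" "x \<noteq> v"
    using E by blast
  then have "x \<in> S"
    using face face_of_imp_subset by blast
  show ?thesis
  proof (cases "l x = t \<or> m x = t")
    case True
    then show ?thesis using x by blast
  next
    case False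
    \<comment> \<open>The coefficient of \<open>z - v\<close> in \<open>x - v\<close>, found by
      applying \<open>l\<close>, which vanishes on \<open>y - v\<close>.\<close>
    define b where "b = (l x - t) / (l z - t)"
    have "t < l x" "t < m x"
      using False ge[OF \<open>x \<in> S\<close>] by auto
    then have "0 < b"
      using z by (simp add: b_def)
    have "l (x - v - b *\<^sub>R (z - v)) = 0"
      using z by (simp add: linear_diff[OF l] linear_scale[OF l] b_def v)
    then obtain a where a: "x - v - b *\<^sub>R (z - v) = a *\<^sub>R (y - v)"
      using kernel_one_dimensional[OF l _ corner_directions(1,4,2)] by blast
    have "m (x - v - b *\<^sub>R (z - v)) = m (a *\<^sub>R (y - v))"
      by (simp only: a)
    then have "m x - t = a * (m y - t)"
      using m v z by (simp add: linear_diff linear_scale)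
    then have "0 < a"
      using \<open>t < m x\<close> y by (metis diff_gt_0_iff_gt zero_less_mult_pos2)
    \<comment> \<open>\<open>\<theta>\<close> moves \<open>x\<close> towards \<open>v\<close>. It is
      at most 1, so the moved point stays in \<open>E\<close>, and
      \<open>\<kappa> = \<theta> * (a + b)\<close> is at most 1, so the endpoints of the segment on
      the two sides stay in \<open>S\<close>.\<close>
    define \<theta> where "\<theta> = min 1 (1 / (a + b))"
    define \<kappa> where "\<kappa> = \<theta> * (a + b)"
    have \<theta>: "0 < \<theta>" "\<theta> \<le> 1"
      using \<open>0 < a\<close> \<open>0 < b\<close> by (auto simp: \<theta>_def)
    have "\<theta> \<le> 1 / (a + b)"
      by (simp add: \<theta>_def)
    then have \<kappa>: "0 < \<kappa>" "\<kappa> \<le> 1"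
      using \<open>0 < a\<close> \<open>0 < b\<close> \<theta> by (auto simp: \<kappa>_def pos_le_divide_eq)
    have seg: "v + c *\<^sub>R (u - v) \<in> T" if "convex T" "v \<in> T" "u \<in> T" "0 \<le> c" "c \<le> 1" for c u T
    proof -
      have "(1 - c) *\<^sub>R v + c *\<^sub>R u \<in> T"
        using that by (intro convexD) auto
      then show ?thesis
        by (simp add: algebra_simps)
    qed
    have "v + \<theta> *\<^sub>R (x - v) \<in> E"
      using \<theta> x E face_of_imp_convex[OF face] by (intro seg) auto
    moreover have "v + \<kappa> *\<^sub>R (y - v) \<in> S" "v + \<kappa> *\<^sub>R (z - v) \<in> S"
      using \<kappa> S v y z by (auto intro!: seg)
    moreover have "v + \<theta> *\<^sub>R (x - v) \<in> open_segment (v + \<kappa> *\<^sub>R (y - v)) (v + \<kappa> *\<^sub>R (z - v))"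
    proof -
      have "x - v = a *\<^sub>R (y - v) + b *\<^sub>R (z - v)"
        using a by (simp add: algebra_simps)
      moreover have "(1 - b / (a + b)) * \<kappa> = \<theta> * a" "(b / (a + b)) * \<kappa> = \<theta> * b"
        using \<open>0 < a\<close> \<open>0 < b\<close> by (simp_all add: \<kappa>_def field_simps)
      moreover have "(1 - c) *\<^sub>R (v + \<kappa> *\<^sub>R f) + c *\<^sub>R (v + \<kappa> *\<^sub>R g) =
          v + ((1 - c) * \<kappa>) *\<^sub>R f + (c * \<kappa>) *\<^sub>R g" for c f g
        by (simp add: algebra_simps)
      ultimately have "v + \<theta> *\<^sub>R (x - v) =
          (1 - b / (a + b)) *\<^sub>R (v + \<kappa> *\<^sub>R (y - v)) + (b / (a + b)) *\<^sub>R (v + \<kappa> *\<^sub>R (z - v))"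
        by (simp add: scaleR_add_right)
      moreover have "v + \<kappa> *\<^sub>R (y - v) \<noteq> v + \<kappa> *\<^sub>R (z - v)"
        using \<kappa> y z by auto
      ultimately show ?thesis
        using \<open>0 < a\<close> \<open>0 < b\<close> by (auto simp: in_segment intro!: exI[of _ "b / (a + b)"])
    qed
    ultimately have "v + \<kappa> *\<^sub>R (y - v) \<in> E"
      using face by (meson face_ofD)
    moreover have "v + \<kappa> *\<^sub>R (y - v) \<noteq> v"
      using \<kappa> v y by auto
    moreover have "l (v + \<kappa> *\<^sub>R (y - v)) = t"
      using l v y by (simp add: linear_add linear_scale linear_diff)
    ultimately show ?thesis by blast
  qed
qed

end

text \<open>Any edge through \<open>v\<close> has a second point on one of the two supporting lines,
  and two common points make it equal to the side on that line.\<close>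

lemma edges_at_corner:
  fixes S :: "(real^2) set" and l m :: "real^2 \<Rightarrow> real"
  assumes "convex S" "linear l" "linear m"
    and "\<And>x. x \<in> S \<Longrightarrow> t \<le> l x" "\<And>x. x \<in> S \<Longrightarrow> t \<le> m x"
    and "v \<in> S" "l v = t" "m v = t"
    and "y \<in> S" "l y = t" "t < m y"
    and "z \<in> S" "m z = t" "t < l z"
  shows "E edge_of S \<and> v \<in> E \<longleftrightarrow> E = S \<inter> {x. l x = t} \<or> E = S \<inter> {x. m x = t}"
    (is "?L \<longleftrightarrow> ?R")
proof
  have L: "S \<inter> {x. l x = t} edge_of S"
    by (rule edge_at_corner[OF assms])
  \<comment> \<open>The hypotheses are symmetric under exchanging \<open>l\<close> with
    \<open>m\<close> and \<open>y\<close> with \<open>z\<close>.\<close>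
  have M: "S \<inter> {x. m x = t} edge_of S"
    by (rule edge_at_corner[OF assms(1,3,2,5,4,6,8,7,12,13,14,9,10,11)])
  show ?L if ?R
    using that
  proof
    assume "E = S \<inter> {x. l x = t}"
    then show ?L
      using L assms(6,7) by simp
  next
    assume "E = S \<inter> {x. m x = t}"
    then show ?L
      using M assms(6,8) by simp
  qed
  assume E: ?L
  then obtain x where x: "x \<in> E" "x \<noteq> v" "l x = t \<or> m x = t"
    using edge_at_corner_meets[OF assms] by blast
  then have "x \<in> S"
    using E face_of_imp_subset by (auto simp: edge_of_def)
  from x(3) show ?R
  proof
    assume "l x = t"
    then have "x \<in> E \<inter> (S \<inter> {x. l x = t})" "v \<in> E \<inter> (S \<inter> {x. l x = t})"
      using E x(1) \<open>x \<in> S\<close> assms(6,7) by simp_all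
    then show ?R
      using edges_eqI[OF _ L] E x(2) by blast
  next
    assume "m x = t"
    then have "x \<in> E \<inter> (S \<inter> {x. m x = t})" "v \<in> E \<inter> (S \<inter> {x. m x = t})"
      using E x(1) \<open>x \<in> S\<close> assms(6,8) by simp_all
    then show ?R
      using edges_eqI[OF _ M] E x(2) by blast
  qed
qed

text \<open>Smaller indices are fixed by induction. A value below \<open>i\<close> would be taken
  twice, contrary to injectivity; if \<open>\<sigma> i\<close> is above \<open>i\<close>, the
  preimage of \<open>i\<close> can lie neither below \<open>i\<close>, where all is fixed, nor
  above, by monotonicity.\<close>

lemma order_automorphism_initial_segment:
  fixes \<sigma> :: "nat \<Rightarrow> nat"
  assumes "bij_betw \<sigma> I I" and mono: "\<And>i j. i \<in> I \<Longrightarrow> j \<in> I \<Longrightarrow> i < j \<Longrightarrow> \<sigma> i < \<sigma> j"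
    and "i \<in> I"
  shows "\<sigma> i = i"
  using \<open>i \<in> I\<close>
proof (induction i rule: less_induct)
  case (less i)
  have surj: "\<sigma> ` I = I" and inj: "inj_on \<sigma> I" and into: "\<sigma> i \<in> I"
    using assms(1) less.prems by (auto simp: bij_betw_def)
  obtain k where k: "k \<in> I" "\<sigma> k = i"
    using surj less.prems by (metis imageE)
  show ?case
  proof (cases "\<sigma> i" i rule: linorder_cases)
    case less
    then have "\<sigma> (\<sigma> i) = \<sigma> i"
      using less.IH into by blast
    then show ?thesis
      using inj into \<open>i \<in> I\<close> by (auto dest: inj_onD)
  next
    case greater
    show ?thesis
    proof (cases k i rule: linorder_cases)
      case less
      then show ?thesis using less.IH k by auto
    next
      case equal
      then show ?thesis using k by simp
    next
      case greater2: greater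
      then show ?thesis using mono[OF less.prems k(1)] greater k by simp
    qed
  qed
qed

section \<open>The caustic of a cone in normal position\<close>

text \<open>The interval \<open>{0<..1}\<close> and not \<open>{0..<1}\<close> is the right range for \<open>\<alpha>\<close>: if \<open>R2\<close> also
  contains a vector completing \<open>e1\<close> to a basis, the caustic is one ray of weight 1, and the
  continued fraction is 1 and not 0.\<close>

locale normalized_cone =
  fixes N :: "(real^2) set" and e1 e2 :: "real^2" and \<alpha> :: real
  assumes basis: "lattice_basis N e1 e2" and \<alpha>: "0 < \<alpha>" "\<alpha> \<le> 1"
begin

section \<open>Coordinates given by the area form\<close>

definition r2 :: "real^2" where
  "r2 = e2 - \<alpha> *\<^sub>R e1"

definition C :: "(real^2) set" where
  "C = {a *\<^sub>R e1 + b *\<^sub>R r2 | a b. 0 \<le> a \<and> 0 \<le> b}"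

text \<open>The normalization \<open>wd e1 e2 = 1\<close> makes the area form integer-valued on
  \<open>N\<close>.\<close>

definition wd :: "real^2 \<Rightarrow> real^2 \<Rightarrow> real" where
  "wd u v = cross2 u v / cross2 e1 e2"

text \<open>The coordinate along \<open>e1\<close> in the basis \<open>e1, r2\<close>, which
  measures the distance to the line of \<open>R2\<close>. The Euclidean algorithm runs on its
  values, starting from \<open>D e1 = 1\<close> and \<open>D e2 = \<alpha>\<close>.\<close>

definition D :: "real^2 \<Rightarrow> real" where
  "D v = wd v r2"

text \<open>\<open>p j\<close> is the vertex of the wave front at time 1 on the ray number \<open>j\<close> of the caustic, and
  \<open>q j\<close> the primitive vector of the side preceding it. When \<open>D q' = 0\<close>, i.e. \<open>q'\<close> is parallel to
  \<open>R2\<close>, the algorithm stops: all later values, as well as the \<open>p\<close> computed in the same step by a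
  division by 0, are junk. The ceiling minus 1, in place of the floor, keeps \<open>D p\<close> positive, so that a
  finite expansion ends with a weight.\<close>

fun state :: "nat \<Rightarrow> (real^2) \<times> (real^2)" where
  "state 0 = (e1, e2)"
| "state (Suc j) =
    (let (q, p) = state j;
         q' = q - of_int \<lfloor>D q / D p\<rfloor> *\<^sub>R p
     in (q', p - of_int (\<lceil>D p / D q'\<rceil> - 1) *\<^sub>R q'))"

definition q :: "nat \<Rightarrow> real^2" where "q j = fst (state j)"
definition p :: "nat \<Rightarrow> real^2" where "p j = snd (state j)"
definition wt :: "nat \<Rightarrow> int" where "wt j = \<lfloor>D (q j) / D (p j)\<rfloor>"
definition gr :: "nat \<Rightarrow> int" where "gr j = \<lceil>D (p j) / D (q (Suc j))\<rceil> - 1"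

text \<open>Downward closed by definition. The indices that satisfy it turn out to number the rays
  of the caustic.\<close>

definition alive :: "nat \<Rightarrow> bool" where
  "alive j \<longleftrightarrow> (\<forall>i\<le>j. D (q i) \<noteq> 0)"

lemma q_0 [simp]: "q 0 = e1" and p_0 [simp]: "p 0 = e2"
  by (simp_all add: q_def p_def)

lemma q_Suc: "q (Suc j) = q j - of_int (wt j) *\<^sub>R p j"
  by (simp add: q_def p_def wt_def case_prod_beta Let_def)

lemma p_Suc: "p (Suc j) = p j - of_int (gr j) *\<^sub>R q (Suc j)"
  by (simp add: q_def p_def gr_def case_prod_beta Let_def)

lemma cross2_e: "cross2 e1 e2 \<noteq> 0"
  using basis by (simp add: lattice_basis_iff)

lemma wd_linear [simp]:
  "wd (u + v) x = wd u x + wd v x" "wd x (u + v) = wd x u + wd x v"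
  "wd (u - v) x = wd u x - wd v x" "wd x (u - v) = wd x u - wd x v"
  "wd (c *\<^sub>R u) x = c * wd u x" "wd x (c *\<^sub>R u) = c * wd x u"
  "wd (- u) x = - wd u x" "wd x (- u) = - wd x u"
  "wd 0 x = 0" "wd x 0 = 0" "wd x x = 0"
  by (simp_all add: wd_def cross2_def algebra_simps diff_divide_distrib add_divide_distrib)

lemma wd_swap: "wd u v = - wd v u"
  by (simp add: wd_def cross2_def algebra_simps diff_divide_distrib)

lemma linear_wd: "linear (wd u)"
  by (rule linearI) simp_all

lemma wd_plucker: "wd u v *\<^sub>R w + wd v w *\<^sub>R u + wd w u *\<^sub>R v = 0"
proof -
  have "wd u v *\<^sub>R w + wd v w *\<^sub>R u + wd w u *\<^sub>R v =
      (1 / cross2 e1 e2) *\<^sub>R (cross2 u v *\<^sub>R w + cross2 v w *\<^sub>R u + cross2 w u *\<^sub>R v)"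
    by (simp add: wd_def scaleR_add_right)
  then show ?thesis
    by (simp add: cross2_plucker)
qed

lemma wd_combination:
  "wd (a *\<^sub>R u + b *\<^sub>R v) (c *\<^sub>R u + d *\<^sub>R v) = (a * d - b * c) * wd u v"
  using wd_swap[of v u] by (simp add: algebra_simps)

text \<open>Cramer's rule for a pair of area 1.\<close>

lemma wd_expand:
  assumes "wd a b = 1"
  shows "v = wd v b *\<^sub>R a + wd a v *\<^sub>R b"
  using wd_plucker[of a b v] assms wd_swap[of b v] wd_swap[of v a]
  by (simp add: algebra_simps eq_neg_iff_add_eq_0)

lemma wd_base [simp]: "wd e1 e2 = 1" "wd e2 e1 = -1" "wd e1 r2 = 1" "wd r2 e1 = -1"
  using cross2_e wd_swap[of e2 e1] wd_swap[of r2 e1] by (simp_all add: r2_def) (simp_all add: wd_def)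

lemma D_linear [simp]:
  "D (u + v) = D u + D v" "D (u - v) = D u - D v" "D (c *\<^sub>R u) = c * D u" "D (- u) = - D u"
  by (simp_all add: D_def)

lemma D_base [simp]: "D e1 = 1" "D r2 = 0" "D e2 = \<alpha>"
  using wd_swap[of e2 r2] by (simp_all add: D_def) (simp add: r2_def)

lemma N_iff: "v \<in> N \<longleftrightarrow> (\<exists>m n :: int. v = of_int m *\<^sub>R e1 + of_int n *\<^sub>R e2)"
  using basis by (auto simp: lattice_basis_def)

lemma wd_Ints: "u \<in> N \<Longrightarrow> v \<in> N \<Longrightarrow> wd u v \<in> \<int>"
  by (auto simp: N_iff)

lemma lattice_basis_in_N: "lattice_basis N b1 b2 \<Longrightarrow> b1 \<in> N \<and> b2 \<in> N"
proof -
  assume "lattice_basis N b1 b2"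
  then have N: "of_int m *\<^sub>R b1 + of_int n *\<^sub>R b2 \<in> N" for m n :: int
    by (auto simp: lattice_basis_def)
  show ?thesis
    using N[of 1 0] N[of 0 1] by simp
qed

text \<open>\<open>e1\<close> and \<open>e2\<close> are integer combinations of \<open>b1\<close>
  and \<open>b2\<close>, so the integer \<open>wd b1 b2\<close> divides
  \<open>wd e1 e2 = 1\<close>.\<close>

lemma abs_wd_lattice_basis:
  assumes "lattice_basis N b1 b2"
  shows "\<bar>wd b1 b2\<bar> = 1"
proof -
  have b: "b1 \<in> N" "b2 \<in> N"
    using lattice_basis_in_N[OF assms] by auto
  have e: "e1 \<in> N" "e2 \<in> N"
    using lattice_basis_in_N[OF basis] by auto
  obtain m n m' n' :: int where
    "e1 = of_int m *\<^sub>R b1 + of_int n *\<^sub>R b2" "e2 = of_int m' *\<^sub>R b1 + of_int n' *\<^sub>R b2"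
    using e assms unfolding lattice_basis_def by blast
  then have "wd e1 e2 = of_int (m * n' - n * m') * wd b1 b2"
    using wd_combination by (metis of_int_diff of_int_mult)
  moreover obtain k :: int where k: "wd b1 b2 = of_int k"
    using wd_Ints[OF b] Ints_cases by blast
  ultimately have "(m * n' - n * m') * k = 1"
    by (metis of_int_eq_1_iff of_int_mult wd_base(1))
  then have "\<bar>k\<bar> = 1"
    by (metis abs_zmult_eq_1 mult.commute abs_1)
  then show ?thesis
    using k by (metis of_int_1 of_int_abs)
qed

lemma abs_wedge_eq: "abs_wedge N v w = \<bar>wd v w\<bar>"
  unfolding abs_wedge_def
proof (rule the_equality)
  have "v = wd v e2 *\<^sub>R e1 + wd e1 v *\<^sub>R e2" "w = wd w e2 *\<^sub>R e1 + wd e1 w *\<^sub>R e2"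
    by (rule wd_expand, simp)+
  moreover from this have "wd v w = wd v e2 * wd e1 w - wd e1 v * wd w e2"
    by (metis wd_combination wd_base(1) mult_1_right)
  ultimately show "\<exists>b1 b2 p q r s. lattice_basis N b1 b2 \<and>
     v = p *\<^sub>R b1 + q *\<^sub>R b2 \<and> w = r *\<^sub>R b1 + s *\<^sub>R b2 \<and> \<bar>wd v w\<bar> = \<bar>p * s - q * r\<bar>"
    by (intro exI conjI) (rule basis, simp_all)
next
  fix d
  assume "\<exists>b1 b2 p q r s. lattice_basis N b1 b2 \<and>
     v = p *\<^sub>R b1 + q *\<^sub>R b2 \<and> w = r *\<^sub>R b1 + s *\<^sub>R b2 \<and> d = \<bar>p * s - q * r\<bar>"
  then obtain b1 b2 p q r s where h: "lattice_basis N b1 b2"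
     "v = p *\<^sub>R b1 + q *\<^sub>R b2" "w = r *\<^sub>R b1 + s *\<^sub>R b2" "d = \<bar>p * s - q * r\<bar>"
    by blast
  have "wd v w = (p * s - q * r) * wd b1 b2"
    by (simp only: h wd_combination)
  then show "d = \<bar>wd v w\<bar>"
    using abs_wd_lattice_basis[OF h(1)] by (simp add: h abs_mult)
qed

section \<open>The Euclidean algorithm on pairs of lattice vectors\<close>

lemma wd_qp [simp]: "wd (q j) (p j) = 1"
  and wd_q_Suc_p [simp]: "wd (q (Suc j)) (p j) = 1"
proof -
  show 1: "wd (q j) (p j) = 1" for j
    by (induction j) (simp_all add: p_Suc q_Suc)
  show "wd (q (Suc j)) (p j) = 1"
    by (simp add: q_Suc 1)
qed

lemma wd_pp: "wd (p j) (p (Suc j)) = gr j"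
  using wd_swap[of "p j" "q (Suc j)"] by (simp add: p_Suc)

lemma wd_qq: "wd (q j) (q (Suc j)) = - wt j"
  by (simp add: q_Suc)

lemma lattice_basis_qp: "lattice_basis N (q j) (p j)"
proof (induction j)
  case 0
  then show ?case using basis by simp
next
  case (Suc j)
  have "lattice_basis N (q (Suc j)) (p j)"
    by (rule lattice_basis_change[OF Suc, of 1 1 "- wt j" 0]) (simp_all add: q_Suc)
  then show ?case
    by (rule lattice_basis_change[of _ _ _ 1 1 0 "- gr j"]) (simp_all add: p_Suc)
qed

lemma q_N: "q j \<in> N" and p_N: "p j \<in> N"
  using lattice_basis_in_N[OF lattice_basis_qp] by auto

lemma alive_0: "alive 0"
  by (simp add: alive_def)

lemma alive_mono: "alive j \<Longrightarrow> i \<le> j \<Longrightarrow> alive i"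
  by (simp add: alive_def)

lemma alive_Suc: "alive (Suc j) \<longleftrightarrow> alive j \<and> D (q (Suc j)) \<noteq> 0"
  by (auto simp: alive_def le_Suc_eq)

text \<open>Division with remainder: \<open>D (q j)\<close> is \<open>wt j\<close> times
  \<open>D (p j)\<close> plus the remainder \<open>D (q (Suc j))\<close>.\<close>

lemma weight_step:
  assumes "0 < D (p j)" "D (p j) \<le> D (q j)"
  shows "1 \<le> wt j" "0 \<le> D (q (Suc j))" "D (q (Suc j)) < D (p j)"
proof -
  have f: "of_int (wt j) \<le> D (q j) / D (p j)" "D (q j) / D (p j) < of_int (wt j) + 1"
    unfolding wt_def by linarith+
  have "1 \<le> D (q j) / D (p j)"
    using assms by simp
  then show "1 \<le> wt j"
    by (simp add: wt_def)
  have "of_int (wt j) * D (p j) \<le> D (q j)" "D (q j) < (of_int (wt j) + 1) * D (p j)"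
    using f assms by (simp_all add: pos_le_divide_eq pos_divide_less_eq)
  then show "0 \<le> D (q (Suc j))" "D (q (Suc j)) < D (p j)"
    by (simp_all add: q_Suc algebra_simps)
qed

text \<open>Division with remainder again, but the ceiling minus 1 puts the remainder
  \<open>D (p (Suc j))\<close> into the interval open at 0 and closed at the divisor. The quotient
  is still at least 1 because the divisor is strictly smaller than \<open>D (p j)\<close>.\<close>

lemma gradient_step:
  assumes "0 < D (q (Suc j))" "D (q (Suc j)) < D (p j)"
  shows "1 \<le> gr j" "0 < D (p (Suc j))" "D (p (Suc j)) \<le> D (q (Suc j))"
proof -
  have f: "of_int (gr j) < D (p j) / D (q (Suc j))" "D (p j) / D (q (Suc j)) \<le> of_int (gr j) + 1"
    unfolding gr_def by linarith+
  have "1 < D (p j) / D (q (Suc j))"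
    using assms by simp
  then show "1 \<le> gr j"
    unfolding gr_def by linarith
  have "of_int (gr j) * D (q (Suc j)) < D (p j)" "D (p j) \<le> (of_int (gr j) + 1) * D (q (Suc j))"
    using f assms by (simp_all add: pos_less_divide_eq pos_divide_le_eq)
  then show "0 < D (p (Suc j))" "D (p (Suc j)) \<le> D (q (Suc j))"
    by (simp_all add: p_Suc algebra_simps)
qed

text \<open>The first two inequalities are what the division steps need. The other two persist
  because each step subtracts a positive multiple of a vector lying on the opposite side of the line
  of \<open>e1\<close>; they put \<open>p j\<close> into the interior of the cone and make
  \<open>wd (q j)\<close> non-negative on it.\<close>

lemma alive_invariant:
  "alive j \<Longrightarrow> 0 < D (p j) \<and> D (p j) \<le> D (q j) \<and> wd e1 (q j) \<le> 0 \<and> 1 \<le> wd e1 (p j)"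
proof (induction j)
  case 0
  then show ?case using \<alpha> by simp
next
  case (Suc j)
  then have IH: "0 < D (p j)" "D (p j) \<le> D (q j)" "wd e1 (q j) \<le> 0" "1 \<le> wd e1 (p j)"
    and ne: "D (q (Suc j)) \<noteq> 0"
    by (auto simp: alive_Suc)
  note w = weight_step[OF IH(1,2)]
  note s = gradient_step[OF _ w(3)]
  have s': "1 \<le> gr j" "0 < D (p (Suc j))" "D (p (Suc j)) \<le> D (q (Suc j))"
    using s ne w by auto
  have "0 \<le> of_int (wt j) * wd e1 (p j)"
    using w IH by simp
  then have q: "wd e1 (q (Suc j)) \<le> 0"
    using IH by (simp add: q_Suc)
  then have "of_int (gr j) * wd e1 (q (Suc j)) \<le> 0"
    using s' by (simp add: mult_nonneg_nonpos)
  then have "1 \<le> wd e1 (p (Suc j))"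
    using IH by (simp add: p_Suc)
  with q s' show ?case by simp
qed

text \<open>The claims on \<open>q (Suc j)\<close> include the case that the algorithm stops there,
  as required for the unbounded last side of the wave front.\<close>

lemma alive_D:
  assumes "alive j"
  shows "0 < D (p j)" "D (p j) \<le> D (q j)" "0 < D (q j)" "1 \<le> wt j"
    "0 \<le> D (q (Suc j))" "D (q (Suc j)) < D (p j)"
    "wd e1 (q j) \<le> 0" "1 \<le> wd e1 (p j)" "wd e1 (q (Suc j)) \<le> 0"
proof -
  show 1: "0 < D (p j)" "D (p j) \<le> D (q j)" "wd e1 (q j) \<le> 0" "1 \<le> wd e1 (p j)"
    using alive_invariant[OF assms] by auto
  then show "0 < D (q j)" by simp
  show "1 \<le> wt j" "0 \<le> D (q (Suc j))" "D (q (Suc j)) < D (p j)"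
    using weight_step[OF 1(1,2)] by auto
  then have "0 \<le> of_int (wt j) * wd e1 (p j)"
    using 1 by simp
  then show "wd e1 (q (Suc j)) \<le> 0"
    using 1 by (simp add: q_Suc)
qed

lemma alive_gr:
  assumes "alive (Suc j)"
  shows "1 \<le> gr j"
  using gradient_step(1)[of j] alive_D[of j] assms by (auto simp: alive_Suc)

section \<open>The cone, its supporting functionals and the wave front\<close>

lemma C_iff: "v \<in> C \<longleftrightarrow> 0 \<le> D v \<and> 0 \<le> wd e1 v"
proof
  assume "v \<in> C"
  then show "0 \<le> D v \<and> 0 \<le> wd e1 v"
    by (auto simp: C_def)
next
  assume "0 \<le> D v \<and> 0 \<le> wd e1 v"
  moreover have "v = D v *\<^sub>R e1 + wd e1 v *\<^sub>R r2"
    unfolding D_def by (rule wd_expand) simp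
  ultimately show "v \<in> C"
    unfolding C_def by blast
qed

lemma e1_C: "e1 \<in> C" and r2_C: "r2 \<in> C"
  by (simp_all add: C_iff)

lemma p_C: "alive j \<Longrightarrow> p j \<in> C"
  using alive_D(1,8)[of j] by (simp add: C_iff)

text \<open>The indices of the sides. If the caustic is finite, there is one more side than there
  are vertices, hence the strict inequality.\<close>

definition reached :: "nat \<Rightarrow> bool" where
  "reached j \<longleftrightarrow> (\<forall>i<j. alive i)"

lemma reached_simps: "alive j \<Longrightarrow> reached j" "alive j \<Longrightarrow> reached (Suc j)"
  by (auto simp: reached_def less_Suc_eq_le intro: alive_mono)

lemma reached_cases: "reached j \<Longrightarrow> j = 0 \<or> (\<exists>i. j = Suc i \<and> alive i)"
  by (cases j) (auto simp: reached_def)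

text \<open>On the generators \<open>e1\<close> and \<open>r2\<close> of the cone the functional
  takes the values \<open>- wd e1 (q j)\<close> and \<open>D (q j)\<close>.\<close>

lemma wd_q_nonneg:
  assumes "reached j" "v \<in> C"
  shows "0 \<le> wd (q j) v"
proof -
  have "0 \<le> D (q j)" "wd e1 (q j) \<le> 0"
    using reached_cases[OF assms(1)] alive_D(5,9) by auto
  moreover obtain a b where v: "v = a *\<^sub>R e1 + b *\<^sub>R r2" "0 \<le> a" "0 \<le> b"
    using assms(2) by (auto simp: C_def)
  moreover have "wd (q j) v = a * - wd e1 (q j) + b * D (q j)"
    using wd_swap[of "q j" e1] by (simp add: v D_def)
  ultimately show ?thesis
    by (metis add_nonneg_nonneg mult_nonneg_nonneg neg_0_le_iff_le)
qed

text \<open>A functional with value 1 at the lattice point \<open>p j\<close> is no proper multiple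
  of another one in the dual lattice.\<close>

lemma primitive_functional_q: "primitive_functional N (wd (q j))"
  unfolding primitive_functional_def
proof (intro conjI ballI allI impI)
  show "wd (q j) \<in> dual_lattice N"
    by (auto simp: dual_lattice_def linear_wd intro: wd_Ints q_N)
  show "wd (q j) \<noteq> (\<lambda>_. 0)"
    by (metis wd_qp zero_neq_one)
  fix m k assume m: "m \<in> dual_lattice N" and k: "wd (q j) = (\<lambda>x. of_int k * m x)"
  have "m (p j) \<in> \<int>"
    using m p_N by (auto simp: dual_lattice_def)
  then obtain i where "m (p j) = of_int i"
    using Ints_cases by blast
  then have "real_of_int (k * i) = 1"
    using fun_cong[OF k, of "p j"] by simp
  then have "k * i = 1"
    by linarith
  then show "\<bar>k\<bar> = 1"
    by (metis abs_zmult_eq_1 abs_1)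
qed

lemma primitive_vector_q: "primitive_vector N (q j)"
  unfolding primitive_vector_def
proof (intro conjI ballI allI impI)
  show "q j \<in> N" by (rule q_N)
  show "q j \<noteq> 0"
    by (metis wd_qp wd_linear(9) zero_neq_one)
  fix u k assume u: "u \<in> N" and k: "q j = of_int k *\<^sub>R u"
  obtain i where "wd u (p j) = of_int i"
    using wd_Ints[OF u p_N] Ints_cases by blast
  then have "real_of_int (k * i) = 1"
    using wd_qp[of j] by (simp add: k)
  then have "k * i = 1"
    by linarith
  then show "\<bar>k\<bar> = 1"
    by (metis abs_zmult_eq_1 abs_1)
qed

lemma wave_front_ge: "reached j \<Longrightarrow> x \<in> wave_front N C t \<Longrightarrow> t \<le> wd (q j) x"
  using primitive_functional_q[of j] wd_q_nonneg[of j] by (auto simp: wave_front_def)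

lemma primitive_functional_linear: "primitive_functional N l \<Longrightarrow> linear l"
  by (simp add: primitive_functional_def dual_lattice_def)

lemma wave_front_add:
  assumes "x \<in> wave_front N C t" "d \<in> C"
  shows "x + d \<in> wave_front N C t"
proof -
  have "t \<le> l (x + d)" if l: "primitive_functional N l" "\<forall>q\<in>C. 0 \<le> l q" for l
  proof -
    have "t \<le> l x" "0 \<le> l d"
      using assms l by (auto simp: wave_front_def)
    then show ?thesis
      using linear_add[OF primitive_functional_linear[OF l(1)]] by simp
  qed
  then show ?thesis
    by (simp add: wave_front_def)
qed

lemma convex_wave_front: "convex (wave_front N C t)"
proof (rule convexI)
  fix x y and u v :: real
  assume h: "x \<in> wave_front N C t" "y \<in> wave_front N C t" "0 \<le> u" "0 \<le> v" "u + v = 1"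
  have "t \<le> l (u *\<^sub>R x + v *\<^sub>R y)" if l: "primitive_functional N l" "\<forall>q\<in>C. 0 \<le> l q" for l
  proof -
    have "t \<le> l x" "t \<le> l y"
      using h(1,2) l by (auto simp: wave_front_def)
    then have "u * t + v * t \<le> u * l x + v * l y"
      using h(3,4) by (intro add_mono mult_left_mono)
    then show ?thesis
      using primitive_functional_linear[OF l(1)] h(5)
      by (simp add: linear_add linear_scale flip: distrib_right)
  qed
  then show "u *\<^sub>R x + v *\<^sub>R y \<in> wave_front N C t"
    by (simp add: wave_front_def)
qed

text \<open>At the lattice point \<open>p j\<close> the functional \<open>l\<close> is a
  non-negative integer. Since both coordinates of \<open>p j\<close> are positive, the value 0 would
  force \<open>l\<close> to vanish on \<open>e1\<close> and \<open>r2\<close>, hence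
  everywhere.\<close>

lemma vertex_in_wave_front:
  assumes "alive j" "0 \<le> t"
  shows "t *\<^sub>R p j \<in> wave_front N C t"
proof -
  have "t \<le> l (t *\<^sub>R p j)" if l: "primitive_functional N l" "\<forall>q\<in>C. 0 \<le> l q" for l
  proof -
    have lin: "linear l" and ints: "\<And>v. v \<in> N \<Longrightarrow> l v \<in> \<int>" and nz: "l \<noteq> (\<lambda>_. 0)"
      using l(1) by (auto simp: primitive_functional_def dual_lattice_def)
    have expand: "l v = D v * l e1 + wd e1 v * l r2" for v
    proof -
      have "v = D v *\<^sub>R e1 + wd e1 v *\<^sub>R r2"
        unfolding D_def by (rule wd_expand) simp
      then have "l v = l (D v *\<^sub>R e1 + wd e1 v *\<^sub>R r2)"
        by (rule arg_cong)
      then show ?thesis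
        by (simp add: linear_add[OF lin] linear_scale[OF lin])
    qed
    have nonneg: "0 \<le> l e1" "0 \<le> l r2"
      using l(2) e1_C r2_C by auto
    have pos: "0 < D (p j)" "0 < wd e1 (p j)"
      using alive_D(1,8)[OF assms(1)] by auto
    have "l (p j) \<noteq> 0"
    proof
      assume "l (p j) = 0"
      then have "D (p j) * l e1 + wd e1 (p j) * l r2 = 0"
        unfolding expand[of "p j"] .
      moreover have "0 \<le> D (p j) * l e1" "0 \<le> wd e1 (p j) * l r2"
        using nonneg pos by simp_all
      ultimately have "D (p j) * l e1 = 0" "wd e1 (p j) * l r2 = 0"
        by linarith+
      then have "l e1 = 0" "l r2 = 0"
        using pos by auto
      then have "l v = 0" for v
        using expand[of v] by simp
      with nz show False by blast
    qed
    moreover have "0 \<le> l (p j)"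
      using l(2) p_C[OF assms(1)] by blast
    moreover obtain i where i: "l (p j) = of_int i"
      using ints[OF p_N] Ints_cases by blast
    ultimately have "1 \<le> l (p j)"
      by simp
    then show ?thesis
      using assms(2) mult_left_mono[of 1 "l (p j)" t] by (simp add: linear_scale[OF lin])
  qed
  then show ?thesis
    by (simp add: wave_front_def)
qed

section \<open>Vertices and sides of the wave front\<close>

abbreviation side :: "nat \<Rightarrow> real \<Rightarrow> (real^2) set" where
  "side j t \<equiv> wave_front N C t \<inter> {x. wd (q j) x = t}"

text \<open>A second point on each of the two sides at the vertex: the neighbouring vertex, or, on
  an unbounded first or last side, a translate of the vertex by \<open>e1\<close> or
  \<open>r2\<close>.\<close>

lemma corner_neighbours:
  assumes "alive j" "0 < t"
  obtains y z where
    "y \<in> wave_front N C t" "wd (q j) y = t" "t < wd (q (Suc j)) y"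
    "z \<in> wave_front N C t" "wd (q (Suc j)) z = t" "t < wd (q j) z"
proof -
  note jj = alive_D[OF assms(1)]
  have w: "1 \<le> real_of_int (wt j)"
    using jj(4) by simp
  \<comment> \<open>The height of a neighbouring vertex over the other side exceeds \<open>t\<close>
    by \<open>t\<close> times a gradient times a weight.\<close>
  have gain: "t < t * (1 + of_int m * of_int n)" if "1 \<le> m" "1 \<le> n" for m n :: int
    using that assms(2) by (simp add: algebra_simps)
  have "\<exists>y. y \<in> wave_front N C t \<and> wd (q j) y = t \<and> t < wd (q (Suc j)) y"
  proof (cases j)
    case 0
    have "t *\<^sub>R p 0 + e1 \<in> wave_front N C t"
      using assms alive_0 by (intro wave_front_add vertex_in_wave_front e1_C) auto
    moreover have "wd (q (Suc 0)) (t *\<^sub>R p 0 + e1) = t + of_int (wt 0)"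
      by (simp add: q_Suc)
    ultimately show ?thesis
      using 0 w by (intro exI[of _ "t *\<^sub>R p 0 + e1"]) simp
  next
    case (Suc i)
    then have i: "alive (Suc i)" "alive i"
      using assms(1) alive_mono[of "Suc i" i] by auto
    have "t *\<^sub>R p i \<in> wave_front N C t"
      using i assms by (intro vertex_in_wave_front) auto
    moreover have "wd (q (Suc (Suc i))) (p i) = 1 + of_int (wt (Suc i)) * of_int (gr i)"
      using wd_pp[of i] wd_swap[of "p (Suc i)" "p i"] by (simp add: q_Suc[of "Suc i"])
    moreover have "t < t * (1 + of_int (wt (Suc i)) * of_int (gr i))"
      using jj(4) Suc alive_gr[OF i(1)] by (intro gain) auto
    ultimately show ?thesis
      using Suc by (intro exI[of _ "t *\<^sub>R p i"]) simp
  qed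
  moreover have "\<exists>z. z \<in> wave_front N C t \<and> wd (q (Suc j)) z = t \<and> t < wd (q j) z"
  proof (cases "alive (Suc j)")
    case True
    have "t *\<^sub>R p (Suc j) \<in> wave_front N C t"
      using True assms by (intro vertex_in_wave_front) auto
    moreover have "wd (q j) (p (Suc j)) = 1 + of_int (gr j) * of_int (wt j)"
      by (simp add: p_Suc wd_qq)
    moreover have "t < t * (1 + of_int (gr j) * of_int (wt j))"
      using jj(4) alive_gr[OF True] by (intro gain) auto
    ultimately show ?thesis
      by (intro exI[of _ "t *\<^sub>R p (Suc j)"]) simp
  next
    case False
    then have "D (q (Suc j)) = 0"
      using assms(1) by (simp add: alive_Suc)
    moreover have "t *\<^sub>R p j + r2 \<in> wave_front N C t"
      using assms by (intro wave_front_add vertex_in_wave_front r2_C) auto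
    ultimately show ?thesis
      using jj(3) by (intro exI[of _ "t *\<^sub>R p j + r2"]) (simp add: D_def)
  qed
  ultimately show ?thesis
    using that by blast
qed

lemma
  assumes "alive j" "0 < t"
  shows vertex_extreme: "t *\<^sub>R p j extreme_point_of wave_front N C t"
    and edges_at_vertex: "E edge_of wave_front N C t \<and> t *\<^sub>R p j \<in> E \<longleftrightarrow> E = side j t \<or> E = side (Suc j) t"
proof -
  obtain y z where yz:
    "y \<in> wave_front N C t" "wd (q j) y = t" "t < wd (q (Suc j)) y"
    "z \<in> wave_front N C t" "wd (q (Suc j)) z = t" "t < wd (q j) z"
    using corner_neighbours[OF assms] .
  have v: "t *\<^sub>R p j \<in> wave_front N C t" "wd (q j) (t *\<^sub>R p j) = t" "wd (q (Suc j)) (t *\<^sub>R p j) = t"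
    using assms by (auto intro: vertex_in_wave_front)
  note corner = convex_wave_front linear_wd[of "q j"] linear_wd[of "q (Suc j)"]
    wave_front_ge[OF reached_simps(1)[OF assms(1)]] wave_front_ge[OF reached_simps(2)[OF assms(1)]]
    v yz
  show "t *\<^sub>R p j extreme_point_of wave_front N C t"
    by (rule extreme_point_at_corner[OF corner])
  show "E edge_of wave_front N C t \<and> t *\<^sub>R p j \<in> E \<longleftrightarrow> E = side j t \<or> E = side (Suc j) t"
    by (rule edges_at_corner[OF corner])
qed

lemma sides_distinct:
  assumes "alive j" "0 < t"
  shows "side j t \<noteq> side (Suc j) t"
proof -
  obtain y where "y \<in> wave_front N C t" "wd (q j) y = t" "t < wd (q (Suc j)) y"
    using corner_neighbours[OF assms] .
  then have "y \<in> side j t" "y \<notin> side (Suc j) t"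
    by auto
  then show ?thesis by blast
qed

text \<open>The wave front is stable under adding cone vectors, so it also contains
  \<open>x + d\<close>, and \<open>x\<close> is the midpoint.\<close>

lemma extreme_point_minus_cone:
  assumes "x extreme_point_of wave_front N C t" "x - d \<in> wave_front N C t" "d \<in> C"
  shows "d = 0"
  using assms(1,2)
proof (rule extreme_point_direction_0)
  show "x + d \<in> wave_front N C t"
    using assms by (intro wave_front_add) (auto simp: extreme_point_of_def)
qed

text \<open>\<open>0 \<le> wd x (p j)\<close> says that \<open>x\<close> does not come after
  \<open>p j\<close> when counted from \<open>R1\<close>. The least such \<open>j\<close> tells the
  sector of \<open>x\<close>: before the first vertex ray, or between two successive ones; if there
  is no such \<open>j\<close>, then \<open>x\<close> is behind the last one. In each case
  subtracting a suitable cone vector stays in the wave front, so that vector is 0.\<close>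

lemma extreme_is_vertex:
  assumes x: "x extreme_point_of wave_front N C t" and t: "0 < t"
  shows "\<exists>j. alive j \<and> x = t *\<^sub>R p j"
proof (cases "\<exists>j. alive j \<and> 0 \<le> wd x (p j)")
  case True
  have xS: "x \<in> wave_front N C t"
    using x by (simp add: extreme_point_of_def)
  define j where "j = (LEAST j. alive j \<and> 0 \<le> wd x (p j))"
  have j: "alive j" "0 \<le> wd x (p j)"
    using LeastI_ex[OF True] by (auto simp: j_def)
  define L where "L = wd (q j) x"
  have L: "t \<le> L"
    unfolding L_def using j xS by (intro wave_front_ge reached_simps)
  show ?thesis
  proof (cases j)
    case 0
    \<comment> \<open>This is \<open>x - t *\<^sub>R p 0\<close>; it lies in the cone because its
      coefficients along \<open>e1\<close> and \<open>e2\<close> are non-negative.\<close>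
    define d where "d = wd x e2 *\<^sub>R e1 + (L - t) *\<^sub>R e2"
    have "x = wd x e2 *\<^sub>R e1 + L *\<^sub>R e2"
      using wd_expand[OF wd_base(1), of x] 0 by (simp add: L_def)
    then have xd: "x - d = t *\<^sub>R p 0"
      by (simp add: d_def algebra_simps)
    have "d \<in> C"
      using j 0 L \<alpha> by (simp add: d_def C_iff)
    moreover have "x - d \<in> wave_front N C t"
      unfolding xd using t alive_0 by (intro vertex_in_wave_front) auto
    ultimately have "d = 0"
      using extreme_point_minus_cone[OF x] by blast
    then show ?thesis
      using xd alive_0 by (intro exI[of _ 0]) simp
  next
    case (Suc i)
    then have i: "alive (Suc i)" "alive i"
      using j(1) alive_mono[of "Suc i" i] by auto
    define s where "s = real_of_int (gr i)"
    have s: "1 \<le> s"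
      using alive_gr[OF i(1)] by (simp add: s_def)
    \<comment> \<open>\<open>a\<close> and \<open>b\<close> are the coordinates of \<open>x\<close>
      with respect to \<open>p i\<close> and \<open>p (Suc i)\<close>. They add up to
      \<open>L\<close> because \<open>wd (q (Suc i))\<close> is 1 at both vectors.\<close>
    define b where "b = - wd x (p i) / s"
    define a where "a = L - b"
    have "\<not> 0 \<le> wd x (p i)"
      using not_less_Least[of i "\<lambda>j. alive j \<and> 0 \<le> wd x (p j)"] i Suc by (simp add: j_def)
    then have b: "0 < b"
      using s by (simp add: b_def divide_neg_pos)
    have ps: "p (Suc i) = p i - s *\<^sub>R q (Suc i)"
      by (simp add: p_Suc s_def)
    have "wd x (p j) = wd x (p i) + s * L"
      using wd_swap[of x "q (Suc i)"] by (simp add: Suc ps L_def)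
    then have "0 \<le> s * a"
      using j(2) s by (simp add: a_def b_def distrib_left)
    then have a: "0 \<le> a"
      using s by (simp add: zero_le_mult_iff)
    have "x = wd x (p i) *\<^sub>R q (Suc i) + L *\<^sub>R p i"
      using wd_expand[OF wd_q_Suc_p[of i], of x] by (simp add: L_def Suc)
    also have "\<dots> = a *\<^sub>R p i + b *\<^sub>R p (Suc i)"
      using s by (simp add: a_def b_def ps algebra_simps)
    finally have xab: "x = a *\<^sub>R p i + b *\<^sub>R p (Suc i)" .
    have xC: "x \<in> C"
      unfolding xab using p_C[OF i(1)] p_C[OF i(2)] a b by (simp add: C_iff)
    have Lpos: "0 < L"
      using L t by simp
    have ab: "a / L + b / L = 1"
      using Lpos by (simp add: a_def flip: add_divide_distrib)
    have V: "t *\<^sub>R p i \<in> wave_front N C t" "t *\<^sub>R p (Suc i) \<in> wave_front N C t"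
      using i t by (auto intro: vertex_in_wave_front)
    have seg: "(t / L) *\<^sub>R x = (a / L) *\<^sub>R (t *\<^sub>R p i) + (b / L) *\<^sub>R (t *\<^sub>R p (Suc i))"
      by (simp add: xab scaleR_add_right mult.commute)
    \<comment> \<open>Shrinking \<open>x\<close> to height \<open>t\<close> brings it onto the
      segment between the two vertices; the difference is a cone vector, which forces
      \<open>L = t\<close>.\<close>
    have "(t / L) *\<^sub>R x \<in> wave_front N C t"
      unfolding seg using a b Lpos ab V by (intro convexD[OF convex_wave_front]) auto
    moreover have "x - (1 - t / L) *\<^sub>R x = (t / L) *\<^sub>R x"
      by (simp add: algebra_simps)
    moreover have "(1 - t / L) *\<^sub>R x \<in> C"
      using xC L Lpos by (simp add: C_iff)
    ultimately have "(1 - t / L) *\<^sub>R x = 0"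
      using extreme_point_minus_cone[OF x] by metis
    moreover have "x \<noteq> 0"
      using Lpos by (auto simp: L_def)
    ultimately have "L = t"
      using Lpos by auto
    then have "x = (t / L) *\<^sub>R x"
      using t by simp
    also have "a / L = 1 - b / L"
      using ab by simp
    note seg[unfolded this]
    finally have "x \<in> closed_segment (t *\<^sub>R p i) (t *\<^sub>R p (Suc i))"
      using a b Lpos by (auto simp: in_segment a_def intro!: exI[of _ "b / L"])
    moreover have "x \<notin> open_segment (t *\<^sub>R p i) (t *\<^sub>R p (Suc i))"
      using x V by (auto simp: extreme_point_of_def)
    ultimately have "x = t *\<^sub>R p i \<or> x = t *\<^sub>R p (Suc i)"
      by (auto simp: open_segment_def)
    then show ?thesis
      using i by blast
  qed
next
  case False
  have xS: "x \<in> wave_front N C t"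
    using x by (simp add: extreme_point_of_def)
  have "\<exists>j. alive j \<and> \<not> alive (Suc j)"
  proof (rule ccontr)
    assume "\<not> ?thesis"
    then have al: "alive j" for j
      by (induction j) (auto simp: alive_0)
    \<comment> \<open>All gradients are at least 1 and \<open>x\<close> has height at least \<open>t\<close> over every side.\<close>
    have "wd x (p 0) + real j * t \<le> wd x (p j)" for j
    proof (induction j)
      case 0
      then show ?case by simp
    next
      case (Suc j)
      have "t \<le> wd (q (Suc j)) x"
        using al xS by (intro wave_front_ge reached_simps)
      moreover have "1 \<le> real_of_int (gr j)"
        using alive_gr[OF al] by simp
      ultimately have "1 * t \<le> of_int (gr j) * wd (q (Suc j)) x"
        using t by (intro mult_mono) auto
      then show ?case
        using Suc wd_swap[of x "q (Suc j)"] by (simp add: p_Suc algebra_simps)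
    qed
    moreover obtain n where "- wd x (p 0) < real n * t"
      using t reals_Archimedean3 by blast
    ultimately have "0 \<le> wd x (p n)"
      by (smt (verit))
    with False al show False by blast
  qed
  then obtain j where j: "alive j" "\<not> alive (Suc j)"
    by blast
  then have D0: "D (q (Suc j)) = 0"
    by (simp add: alive_Suc)
  define L where "L = wd (q (Suc j)) x"
  \<comment> \<open>Here \<open>d\<close> is \<open>x - t *\<^sub>R p j\<close>. It lies in the
    cone: \<open>q (Suc j)\<close> is a non-positive multiple of \<open>r2\<close>, and its
    coefficient \<open>wd x (p j)\<close> is non-positive as well.\<close>
  define d where "d = wd x (p j) *\<^sub>R q (Suc j) + (L - t) *\<^sub>R p j"
  have L: "t \<le> L"
    unfolding L_def using j xS by (intro wave_front_ge reached_simps)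
  have "x = wd x (p j) *\<^sub>R q (Suc j) + L *\<^sub>R p j"
    using wd_expand[OF wd_q_Suc_p[of j], of x] by (simp add: L_def)
  then have xd: "x - d = t *\<^sub>R p j"
    by (simp add: d_def algebra_simps)
  have "wd x (p j) \<le> 0"
    using False j(1) by (simp add: not_le less_imp_le)
  then have "d \<in> C"
    using L alive_D[OF j(1)] by (simp add: d_def C_iff D0 mult_nonpos_nonpos)
  moreover have "x - d \<in> wave_front N C t"
    unfolding xd using t j by (intro vertex_in_wave_front) auto
  ultimately have "d = 0"
    using extreme_point_minus_cone[OF x] by blast
  then show ?thesis
    using xd j by auto
qed

section \<open>The rays of the caustic and their order\<close>

lemma caustic_eq: "caustic N C = (\<Union>j\<in>Collect alive. open_ray (p j))"
proof
  show "caustic N C \<subseteq> (\<Union>j\<in>Collect alive. open_ray (p j))"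
    using extreme_is_vertex by (fastforce simp: caustic_def open_ray_def)
  show "(\<Union>j\<in>Collect alive. open_ray (p j)) \<subseteq> caustic N C"
    using vertex_extreme by (auto simp: caustic_def open_ray_def)
qed

lemma open_ray_eqI:
  assumes "v \<in> open_ray u"
  shows "open_ray v = open_ray u"
proof -
  obtain c where c: "0 < c" "v = c *\<^sub>R u"
    using assms by (auto simp: open_ray_def)
  have "k *\<^sub>R u \<in> open_ray v" if "0 < k" for k
    using that c unfolding open_ray_def by (auto intro!: exI[of _ "k / c"])
  moreover have "k *\<^sub>R v \<in> open_ray u" if "0 < k" for k
    using that c unfolding open_ray_def by (auto intro!: exI[of _ "k * c"])
  ultimately show ?thesis
    by (auto simp: open_ray_def)
qed

lemma p_nonzero: "p j \<noteq> 0"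
  using wd_qp[of j] by (metis wd_linear(10) zero_neq_one)

lemma self_in_open_ray: "v \<in> open_ray v"
  by (auto simp: open_ray_def intro!: exI[of _ 1])

lemma caustic_rays_eq: "caustic_rays N C = (\<lambda>j. open_ray (p j)) ` Collect alive"
proof
  show "caustic_rays N C \<subseteq> (\<lambda>j. open_ray (p j)) ` Collect alive"
  proof
    fix W assume "W \<in> caustic_rays N C"
    then obtain v where v: "open_ray v \<subseteq> caustic N C" "W = open_ray v"
      by (auto simp: caustic_rays_def)
    then obtain j where "alive j" "v \<in> open_ray (p j)"
      using self_in_open_ray[of v] by (auto simp: caustic_eq)
    then show "W \<in> (\<lambda>j. open_ray (p j)) ` Collect alive"
      using v open_ray_eqI by blast
  qed
  show "(\<lambda>j. open_ray (p j)) ` Collect alive \<subseteq> caustic_rays N C"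
    using p_nonzero by (auto simp: caustic_rays_def caustic_eq)
qed

text \<open>Successive vectors have area \<open>gr\<close>, at least 1. To pass to arbitrary pairs a
  transitive relation is needed: in the half plane where \<open>wd e1\<close> is positive, the sign
  of the area compares slopes.\<close>

lemma wd_p_pos:
  assumes "alive j" "i < j"
  shows "0 < wd (p i) (p j)"
proof -
  have wd_eq: "wd u v = wd u e2 * wd e1 v - wd e1 u * wd v e2" for u v
    using wd_combination[of "wd u e2" e1 "wd e1 u" e2 "wd v e2" "wd e1 v"]
      wd_expand[OF wd_base(1), of u] wd_expand[OF wd_base(1), of v] by simp
  define sl where "sl j = wd (p j) e2 / wd e1 (p j)" for j
  have sl: "sl k < sl i \<longleftrightarrow> 0 < wd (p i) (p k)" if "alive i" "alive k" for i k
    using alive_D(8)[OF that(1)] alive_D(8)[OF that(2)]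
    by (simp add: sl_def wd_eq[of "p i" "p k"] field_simps)
  have "sl j < sl i"
    using assms
  proof (induction j)
    case (Suc j)
    then have "alive j" by (auto simp: alive_Suc)
    then have "sl (Suc j) < sl j"
      using sl[of j "Suc j"] Suc alive_gr[of j] by (simp add: wd_pp)
    with Suc \<open>alive j\<close> show ?case
      by (cases "i = j") auto
  qed simp
  then show ?thesis
    using sl[of i j] assms alive_mono[of j i] by simp
qed

lemma wd_p_nonneg_iff:
  assumes "alive i" "alive j"
  shows "0 \<le> wd (p i) (p j) \<longleftrightarrow> i \<le> j"
  using wd_p_pos[OF assms(1), of j] wd_p_pos[OF assms(2), of i] wd_swap[of "p i" "p j"]
  by (cases i j rule: linorder_cases) auto

lemma open_ray_p_eq_iff:
  assumes "alive i" "alive j"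
  shows "open_ray (p i) = open_ray (p j) \<longleftrightarrow> i = j"
proof
  assume "open_ray (p i) = open_ray (p j)"
  then have "p i \<in> open_ray (p j)"
    using self_in_open_ray by metis
  then have "wd (p i) (p j) = 0"
    by (auto simp: open_ray_def)
  then have "0 \<le> wd (p i) (p j)" "0 \<le> wd (p j) (p i)"
    using wd_swap[of "p i" "p j"] by simp_all
  then show "i = j"
    using wd_p_nonneg_iff assms by (meson antisym)
qed simp

text \<open>In one direction, the half plane of all \<open>v\<close> with
  \<open>0 \<le> wd v (p j)\<close> is convex and contains both rays that span the hull. In the
  other, \<open>p i\<close> is a positive combination of \<open>e1\<close> and
  \<open>p j\<close>.\<close>

lemma closer_to_iff:
  assumes "alive i" "alive j"
  shows "closer_to (ray e1) (open_ray (p i)) (open_ray (p j)) \<longleftrightarrow> i < j"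
proof
  assume "closer_to (ray e1) (open_ray (p i)) (open_ray (p j))"
  then have h: "open_ray (p i) \<noteq> open_ray (p j)" "p i \<in> convex hull (ray e1 \<union> open_ray (p j))"
    using self_in_open_ray by (auto simp: closer_to_def)
  have "linear (\<lambda>v. wd v (p j))"
    by (rule linearI) simp_all
  then have "convex ((\<lambda>v. wd v (p j)) -` {0..})"
    by (intro convex_linear_vimage) auto
  moreover have "ray e1 \<union> open_ray (p j) \<subseteq> (\<lambda>v. wd v (p j)) -` {0..}"
    using alive_D(8)[OF assms(2)] by (auto simp: ray_def open_ray_def)
  ultimately have "p i \<in> (\<lambda>v. wd v (p j)) -` {0..}"
    using h(2) hull_minimal[of _ _ convex] by blast
  then have "i \<le> j"
    using wd_p_nonneg_iff[OF assms] by simp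
  with h show "i < j"
    by (cases "i = j") auto
next
  assume ij: "i < j"
  have Y: "0 < wd e1 (p i)" "0 < wd e1 (p j)"
    using alive_D(8)[OF assms(1)] alive_D(8)[OF assms(2)] by simp_all
  define r where "r = wd (p i) (p j) / wd e1 (p j)"
  define c where "c = wd e1 (p i) / wd e1 (p j)"
  have rc: "0 < r" "0 < c"
    using Y wd_p_pos[OF assms(2) ij] by (simp_all add: r_def c_def)
  have "wd e1 (p j) *\<^sub>R p i = wd (p i) (p j) *\<^sub>R e1 + wd e1 (p i) *\<^sub>R p j"
    using wd_plucker[of e1 "p j" "p i"] wd_swap[of "p j" "p i"] wd_swap[of "p i" e1]
    by (simp add: algebra_simps eq_neg_iff_add_eq_0)
  then have "(1 / wd e1 (p j)) *\<^sub>R (wd e1 (p j) *\<^sub>R p i) = r *\<^sub>R e1 + c *\<^sub>R p j"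
    by (simp add: r_def c_def scaleR_add_right)
  then have pi: "p i = r *\<^sub>R e1 + c *\<^sub>R p j"
    using Y by simp
  have "open_ray (p i) \<subseteq> convex hull (ray e1 \<union> open_ray (p j))"
  proof
    fix v assume "v \<in> open_ray (p i)"
    then obtain k where k: "0 < k" "v = k *\<^sub>R p i"
      by (auto simp: open_ray_def)
    \<comment> \<open>The factors 2 compensate the weights 1/2 of the convex combination.\<close>
    have "(2 * k * r) *\<^sub>R e1 \<in> ray e1" "(2 * k * c) *\<^sub>R p j \<in> open_ray (p j)"
      using rc k by (auto simp: ray_def open_ray_def)
    then have "(1/2) *\<^sub>R ((2 * k * r) *\<^sub>R e1) + (1/2) *\<^sub>R ((2 * k * c) *\<^sub>R p j)
        \<in> convex hull (ray e1 \<union> open_ray (p j))"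
      by (intro convexD convex_convex_hull) (auto intro: hull_inc)
    also have "(1/2) *\<^sub>R ((2 * k * r) *\<^sub>R e1) + (1/2) *\<^sub>R ((2 * k * c) *\<^sub>R p j) = v"
      by (simp add: k(2) pi scaleR_add_right)
    finally show "v \<in> convex hull (ray e1 \<union> open_ray (p j))" .
  qed
  then show "closer_to (ray e1) (open_ray (p i)) (open_ray (p j))"
    using ij open_ray_p_eq_iff[OF assms] by (simp add: closer_to_def)
qed

section \<open>Weights, length gradients and the tropical cotangent\<close>

lemma extreme_on_ray:
  assumes "x extreme_point_of wave_front N C t" "0 < t" "x \<in> open_ray (p j)" "alive j"
  shows "x = t *\<^sub>R p j"
proof -
  obtain i where i: "alive i" "x = t *\<^sub>R p i"
    using extreme_is_vertex[OF assms(1,2)] by blast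
  then have "open_ray x = open_ray (p i)"
    using assms(2) by (intro open_ray_eqI) (auto simp: open_ray_def)
  moreover have "open_ray x = open_ray (p j)"
    using assms(3) by (rule open_ray_eqI)
  ultimately have "i = j"
    using open_ray_p_eq_iff[OF i(1) assms(4)] by simp
  with i show ?thesis by simp
qed

lemma primitive_vector_collinear:
  assumes "primitive_vector N v" "wd (q j) v = 0"
  shows "v = q j \<or> v = - q j"
proof -
  have v: "v = wd v (p j) *\<^sub>R q j"
    using wd_expand[OF wd_qp[of j], of v] assms(2) by simp
  moreover obtain k :: int where k: "wd v (p j) = of_int k"
    using wd_Ints[OF _ p_N, of v] assms(1) Ints_cases by (auto simp: primitive_vector_def)
  ultimately have "\<bar>k\<bar> = 1"
    using assms(1) q_N[of j] by (auto simp: primitive_vector_def)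
  then have "k = 1 \<or> k = -1"
    by linarith
  with v k show ?thesis
    by auto
qed

lemma primitive_vector_parallel_side:
  assumes "primitive_vector N v" "parallel_to v (side j t)" "x \<in> side j t" "y \<in> side j t" "x \<noteq> y"
  shows "v = q j \<or> v = - q j"
proof -
  have "wd (q j) (y - x) = 0"
    using assms by simp
  moreover obtain c where c: "y - x = c *\<^sub>R v"
    using assms(2-4) by (auto simp: parallel_to_def)
  moreover have "c \<noteq> 0"
    using c assms(5) by auto
  ultimately have "wd (q j) v = 0"
    by simp
  with assms(1) show ?thesis
    by (rule primitive_vector_collinear)
qed

lemma parallel_to_side: "parallel_to (q j) (side j t)"
  unfolding parallel_to_def
proof (intro conjI ballI)
  show "q j \<noteq> 0"
    using primitive_vector_q by (simp add: primitive_vector_def)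
  fix a b assume "a \<in> side j t" "b \<in> side j t"
  then have "wd (q j) (b - a) = 0"
    by simp
  then show "\<exists>c. b - a = c *\<^sub>R q j"
    using wd_expand[OF wd_qp[of j], of "b - a"] by auto
qed

text \<open>All choices in the definition are forced up to sign: the ray and \<open>t\<close>
  determine the vertex, which lies on exactly two edges, and each edge determines its primitive
  vector up to sign.\<close>

lemma ray_weight_eq:
  assumes "alive j"
  shows "ray_weight N C (open_ray (p j)) = of_int (wt j)"
  unfolding ray_weight_def
proof (rule the_equality)
  have w: "abs_wedge N (q j) (q (Suc j)) = of_int (wt j)"
    using alive_D(4)[OF assms] by (simp add: abs_wedge_eq wd_qq)
  have E: "side j 1 edge_of wave_front N C 1" "1 *\<^sub>R p j \<in> side j 1"
    "side (Suc j) 1 edge_of wave_front N C 1" "1 *\<^sub>R p j \<in> side (Suc j) 1"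
    using edges_at_vertex[OF assms zero_less_one, of "side j 1"]
      edges_at_vertex[OF assms zero_less_one, of "side (Suc j) 1"] by blast+
  show "\<exists>t>0. \<exists>x\<in>open_ray (p j). \<exists>E F v w.
     x extreme_point_of wave_front N C t \<and>
     E edge_of wave_front N C t \<and> F edge_of wave_front N C t \<and> E \<noteq> F \<and> x \<in> E \<and> x \<in> F \<and>
     primitive_vector N v \<and> parallel_to v E \<and>
     primitive_vector N w \<and> parallel_to w F \<and>
     of_int (wt j) = abs_wedge N v w"
    by (intro exI[of _ 1] conjI bexI[of _ "1 *\<^sub>R p j"] exI[of _ "side j 1"] exI[of _ "side (Suc j) 1"]
        exI[of _ "q j"] exI[of _ "q (Suc j)"] vertex_extreme sides_distinct primitive_vector_q
        parallel_to_side assms zero_less_one E w[symmetric])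
      (simp add: self_in_open_ray)
next
  fix m
  assume "\<exists>t>0. \<exists>x\<in>open_ray (p j). \<exists>E F v w.
     x extreme_point_of wave_front N C t \<and>
     E edge_of wave_front N C t \<and> F edge_of wave_front N C t \<and> E \<noteq> F \<and> x \<in> E \<and> x \<in> F \<and>
     primitive_vector N v \<and> parallel_to v E \<and>
     primitive_vector N w \<and> parallel_to w F \<and>
     m = abs_wedge N v w"
  then obtain t x E F v w where h: "0 < t" "x \<in> open_ray (p j)" "x extreme_point_of wave_front N C t"
     "E edge_of wave_front N C t" "F edge_of wave_front N C t" "E \<noteq> F" "x \<in> E" "x \<in> F"
     "primitive_vector N v" "parallel_to v E" "primitive_vector N w" "parallel_to w F"
     "m = abs_wedge N v w"
    by blast
  have x: "x = t *\<^sub>R p j"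
    using extreme_on_ray[OF h(3,1,2) assms] .
  have EF: "E = side j t \<or> E = side (Suc j) t" "F = side j t \<or> F = side (Suc j) t"
    using edges_at_vertex[OF assms h(1)] h(4-8) unfolding x by blast+
  obtain y z where yz:
    "y \<in> wave_front N C t" "wd (q j) y = t" "t < wd (q (Suc j)) y"
    "z \<in> wave_front N C t" "wd (q (Suc j)) z = t" "t < wd (q j) z"
    using corner_neighbours[OF assms h(1)] .
  have xS: "x \<in> side j t" "x \<in> side (Suc j) t"
    using edges_at_vertex[OF assms h(1), of "side j t"]
      edges_at_vertex[OF assms h(1), of "side (Suc j) t"] unfolding x by blast+
  have wx: "wd (q j) x = t" "wd (q (Suc j)) x = t"
    by (simp_all add: x)
  then have xyz: "x \<noteq> y" "x \<noteq> z"
    using yz by auto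
  have yS: "y \<in> side j t" and zS: "z \<in> side (Suc j) t"
    using yz by auto
  have P: "u = q j \<or> u = - q j" if "primitive_vector N u" "parallel_to u (side j t)" for u
    by (rule primitive_vector_parallel_side[OF that xS(1) yS xyz(1)])
  have Q: "u = q (Suc j) \<or> u = - q (Suc j)" if "primitive_vector N u" "parallel_to u (side (Suc j) t)" for u
    by (rule primitive_vector_parallel_side[OF that xS(2) zS xyz(2)])
  have "\<bar>wd v w\<bar> = \<bar>wd (q j) (q (Suc j))\<bar>"
  proof (cases "E = side j t")
    case True
    then have F: "F = side (Suc j) t"
      using EF h(6) by metis
    show ?thesis
      using P[OF h(9) h(10)[unfolded True]] Q[OF h(11) h(12)[unfolded F]] by auto
  next
    case False
    then have E: "E = side (Suc j) t" and F: "F = side j t"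
      using EF h(6) by metis+
    show ?thesis
      using Q[OF h(9) h(10)[unfolded E]] P[OF h(11) h(12)[unfolded F]]
        wd_swap[of "q j" "q (Suc j)"] by auto
  qed
  then show "m = of_int (wt j)"
    using alive_D(4)[OF assms] by (simp add: h(13) abs_wedge_eq wd_qq)
qed

text \<open>The inequalities of the preceding side \<open>q j\<close> and the following side
  \<open>q (Suc (Suc j))\<close> cut the line of this side down to the segment.\<close>

lemma side_bounded:
  assumes "alive (Suc j)" "0 < t"
  shows "side (Suc j) t = closed_segment (t *\<^sub>R p j) (t *\<^sub>R p (Suc j))"
proof
  have j: "alive j"
    using assms(1) by (simp add: alive_Suc)
  define s where "s = real_of_int (gr j)"
  have s: "1 \<le> s"
    using alive_gr[OF assms(1)] by (simp add: s_def)
  show "side (Suc j) t \<subseteq> closed_segment (t *\<^sub>R p j) (t *\<^sub>R p (Suc j))"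
  proof
    fix x assume "x \<in> side (Suc j) t"
    then have x: "x \<in> wave_front N C t" "wd (q (Suc j)) x = t"
      by auto
    \<comment> \<open>The parameter of \<open>x\<close> on the segment: from the first vertex to the
      second, \<open>wd x (p j)\<close> runs from 0 to \<open>- (s * t)\<close>.\<close>
    define u where "u = - wd x (p j) / (s * t)"
    have us: "wd x (p j) = - (u * s * t)"
      using s assms(2) by (simp add: u_def)
    have expand: "x = wd x (p j) *\<^sub>R q (Suc j) + t *\<^sub>R p j"
      using wd_expand[OF wd_q_Suc_p[of j], of x] x by simp
    have "t \<le> wd (q j) x"
      using x(1) j by (intro wave_front_ge reached_simps)
    moreover have "wd (q j) x = t + of_int (wt j) * (- wd x (p j))"
      using x(2) wd_swap[of x "p j"] by (simp add: q_Suc)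
    ultimately have "0 \<le> of_int (wt j) * (- wd x (p j))"
      by linarith
    then have "wd x (p j) \<le> 0"
      using alive_D(4)[OF j] by (simp add: mult_le_0_iff)
    then have u0: "0 \<le> u"
      using s assms(2) by (simp add: u_def divide_nonpos_pos)
    have "t \<le> wd (q (Suc (Suc j))) x"
      using x(1) assms by (intro wave_front_ge reached_simps)
    moreover have "wd (q (Suc (Suc j))) x = t + of_int (wt (Suc j)) * (wd x (p j) + s * t)"
      using x(2) wd_swap[of x "p j"] wd_swap[of "p (Suc j)" x] wd_swap[of x "q (Suc j)"]
      by (simp add: q_Suc[of "Suc j"]) (simp add: p_Suc s_def algebra_simps)
    ultimately have "0 \<le> of_int (wt (Suc j)) * (wd x (p j) + s * t)"
      by linarith
    then have "0 \<le> wd x (p j) + s * t"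
      using alive_D(4)[OF assms(1)] by (simp add: zero_le_mult_iff)
    then have "- wd x (p j) \<le> 1 * (s * t)"
      by simp
    then have "u \<le> 1"
      unfolding u_def using s assms(2) by (subst pos_divide_le_eq) auto
    moreover have "x = (1 - u) *\<^sub>R (t *\<^sub>R p j) + u *\<^sub>R (t *\<^sub>R p (Suc j))"
      by (subst expand) (simp add: us p_Suc s_def algebra_simps)
    ultimately show "x \<in> closed_segment (t *\<^sub>R p j) (t *\<^sub>R p (Suc j))"
      using u0 by (auto simp: in_segment)
  qed
  have "convex (side (Suc j) t)"
    using face_of_imp_convex[OF face_of_linear_min[OF convex_wave_front linear_wd wave_front_ge]]
      reached_simps(2)[OF j] by blast
  moreover have "t *\<^sub>R p j \<in> side (Suc j) t" "t *\<^sub>R p (Suc j) \<in> side (Suc j) t"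
    using assms j by (auto intro!: vertex_in_wave_front)
  ultimately show "closed_segment (t *\<^sub>R p j) (t *\<^sub>R p (Suc j)) \<subseteq> side (Suc j) t"
    by (rule closed_segment_subset[rotated 2])
qed

text \<open>Endpoints of an edge are extreme points of the wave front, and each ray carries just one
  of these at time \<open>t\<close>.\<close>

lemma connecting_edge_eq:
  assumes "alive (Suc j)" "0 < t"
  shows "connecting_edge N C (open_ray (p j)) (open_ray (p (Suc j))) t =
    closed_segment (t *\<^sub>R p j) (t *\<^sub>R p (Suc j))"
  unfolding connecting_edge_def
proof (rule the_equality)
  have j: "alive j"
    using assms(1) by (simp add: alive_Suc)
  have "side (Suc j) t edge_of wave_front N C t"
    using edges_at_vertex[OF assms, of "side (Suc j) t"] by blast
  moreover have "t *\<^sub>R p i \<in> open_ray (p i)" for i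
    using assms by (auto simp: open_ray_def)
  ultimately show "closed_segment (t *\<^sub>R p j) (t *\<^sub>R p (Suc j)) edge_of wave_front N C t \<and>
      (\<exists>x\<in>open_ray (p j). \<exists>y\<in>open_ray (p (Suc j)).
        closed_segment (t *\<^sub>R p j) (t *\<^sub>R p (Suc j)) = closed_segment x y)"
    unfolding side_bounded[OF assms] by blast
  fix E
  assume "E edge_of wave_front N C t \<and> (\<exists>x\<in>open_ray (p j). \<exists>y\<in>open_ray (p (Suc j)). E = closed_segment x y)"
  then obtain x y where h: "E edge_of wave_front N C t" "x \<in> open_ray (p j)" "y \<in> open_ray (p (Suc j))"
    "E = closed_segment x y"
    by blast
  have face: "E face_of wave_front N C t"
    using h(1) by (simp add: edge_of_def)
  have "x extreme_point_of E" "y extreme_point_of E"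
    by (simp_all add: h(4) extreme_point_of_segment)
  then have "x extreme_point_of wave_front N C t" "y extreme_point_of wave_front N C t"
    using extreme_point_of_face[OF face] by auto
  then have "x = t *\<^sub>R p j" "y = t *\<^sub>R p (Suc j)"
    using extreme_on_ray assms j h by auto
  then show "E = closed_segment (t *\<^sub>R p j) (t *\<^sub>R p (Suc j))"
    using h by simp
qed

lemma tropical_length_segment:
  assumes "a - b = l *\<^sub>R q j" "0 \<le> l"
  shows "tropical_length N (closed_segment a b) = l"
  unfolding tropical_length_def
proof (rule the_equality)
  have "b - a = - (l *\<^sub>R q j)"
    using assms(1) by (metis minus_diff_eq)
  then show "0 \<le> l \<and> (\<exists>a' b' u. closed_segment a b = closed_segment a' b' \<and>
     primitive_vector N u \<and> (b' - a' = l *\<^sub>R u \<or> b' - a' = - (l *\<^sub>R u)))"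
    using assms(2) primitive_vector_q by blast
  fix k
  assume "0 \<le> k \<and> (\<exists>a' b' u. closed_segment a b = closed_segment a' b' \<and>
     primitive_vector N u \<and> (b' - a' = k *\<^sub>R u \<or> b' - a' = - (k *\<^sub>R u)))"
  then obtain a' b' v where h: "0 \<le> k" "closed_segment a b = closed_segment a' b'"
    "primitive_vector N v" "b' - a' = k *\<^sub>R v \<or> b' - a' = - (k *\<^sub>R v)"
    by blast
  have "{a, b} = {a', b'}"
    using h(2) by (simp add: closed_segment_eq)
  moreover define M where "M = b' - a'"
  ultimately have "l *\<^sub>R q j = M \<or> l *\<^sub>R q j = - M"
    using assms(1) by (auto simp: doubleton_eq_iff)
  moreover have "M = k *\<^sub>R v \<or> M = - (k *\<^sub>R v)"
    using h(4) by (simp add: M_def)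
  ultimately have lk: "l *\<^sub>R q j = k *\<^sub>R v \<or> l *\<^sub>R q j = (- k) *\<^sub>R v"
    by auto
  have qv: "q j \<noteq> 0" "v \<noteq> 0"
    using primitive_vector_q[of j] h(3) by (simp_all add: primitive_vector_def)
  \<comment> \<open>For \<open>k = 0\<close> the segment is a point and says nothing about the
    direction of \<open>v\<close>.\<close>
  have "v = q j \<or> v = - q j" if "k \<noteq> 0"
  proof (rule primitive_vector_collinear[OF h(3)])
    have "wd (q j) (l *\<^sub>R q j) = 0"
      by simp
    then have "k * wd (q j) v = 0"
      using lk by (metis mult_minus_left neg_equal_0_iff_equal wd_linear(6))
    with that show "wd (q j) v = 0"
      by simp
  qed
  then have "l *\<^sub>R q j = k *\<^sub>R q j \<or> l *\<^sub>R q j = (- k) *\<^sub>R q j"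
    using lk by (cases "k = 0") auto
  then have "l = k \<or> l = - k"
    using qv(1) scaleR_right_imp_eq by blast
  then show "k = l"
    using h(1) assms(2) by auto
qed

lemma length_gradient_eq:
  assumes "alive (Suc j)"
  shows "length_gradient N C (open_ray (p j)) (open_ray (p (Suc j))) = of_int (gr j)"
    (is "length_gradient N C ?W ?W' = _")
  unfolding length_gradient_def
proof (rule the_equality)
  have len: "tropical_length N (connecting_edge N C ?W ?W' t) = t * of_int (gr j)" if "0 < t" for t
    unfolding connecting_edge_eq[OF assms that]
  proof (rule tropical_length_segment)
    show "t *\<^sub>R p j - t *\<^sub>R p (Suc j) = (t * of_int (gr j)) *\<^sub>R q (Suc j)"
      by (simp add: p_Suc scaleR_diff_right)
    show "0 \<le> t * of_int (gr j)"
      using that alive_gr[OF assms] by simp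
  qed
  have D: "((\<lambda>\<tau>. tropical_length N (connecting_edge N C ?W ?W' \<tau>)) has_real_derivative of_int (gr j)) (at t)"
    if "0 < t" for t
  proof (rule has_field_derivative_transform_within_open[where S = "{0<..}"])
    show "((\<lambda>\<tau>. \<tau> * of_int (gr j)) has_real_derivative of_int (gr j)) (at t)"
      by (auto intro!: derivative_eq_intros)
  qed (use that len in auto)
  then show "\<forall>t>0. ((\<lambda>\<tau>. tropical_length N (connecting_edge N C ?W ?W' \<tau>)) has_real_derivative of_int (gr j)) (at t)"
    by blast
  fix g
  assume "\<forall>t>0. ((\<lambda>\<tau>. tropical_length N (connecting_edge N C ?W ?W' \<tau>)) has_real_derivative g) (at t)"
  then show "g = of_int (gr j)"
    using D[of 1] DERIV_unique zero_less_one by blast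
qed

text \<open>Independence of the choices: \<open>b1\<close> is forced to be \<open>e1\<close>;
  \<open>b2 + s *\<^sub>R b1\<close> is a non-negative multiple of \<open>r2\<close> and has area 1
  with \<open>e1\<close>, so it equals \<open>r2\<close>. Comparing coordinates along
  \<open>e1\<close>, \<open>- s\<close> and \<open>\<alpha>\<close> differ by the integer
  \<open>wd b2 e2\<close>.\<close>

lemma tropical_cotangent_eq: "tropical_cotangent N (ray e1) (ray r2) = mod_Z \<alpha>"
  unfolding tropical_cotangent_def
proof (rule the_equality)
  have self: "v \<in> ray v" for v
    by (auto simp: ray_def intro!: exI[of _ 1])
  have "e2 + (- \<alpha>) *\<^sub>R e1 \<in> ray r2"
    using self[of r2] by (simp add: r2_def)
  then show "\<exists>b1 b2 s. primitive_vector N b1 \<and> ray e1 = ray b1 \<and>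
     lattice_basis N b1 b2 \<and> b2 + s *\<^sub>R b1 \<in> ray r2 \<and> mod_Z \<alpha> = mod_Z (- s)"
    using primitive_vector_q[of 0] basis by (intro exI[of _ e1] exI[of _ e2] exI[of _ "- \<alpha>"]) simp
  fix T
  assume "\<exists>b1 b2 s. primitive_vector N b1 \<and> ray e1 = ray b1 \<and>
     lattice_basis N b1 b2 \<and> b2 + s *\<^sub>R b1 \<in> ray r2 \<and> T = mod_Z (- s)"
  then obtain b1 b2 s where h: "primitive_vector N b1" "ray e1 = ray b1" "lattice_basis N b1 b2"
     "b2 + s *\<^sub>R b1 \<in> ray r2" "T = mod_Z (- s)"
    by blast
  obtain c where c: "0 \<le> c" "b1 = c *\<^sub>R e1"
    using h(2) self[of b1] by (auto simp: ray_def)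
  have "b1 = e1 \<or> b1 = - e1"
    using primitive_vector_collinear[OF h(1), of 0] c by simp
  moreover have "b1 \<noteq> - e1"
    using c wd_base(1) by (metis mult.right_neutral neg_0_le_iff_le not_one_le_zero wd_linear(5,7))
  ultimately have b1: "b1 = e1"
    by blast
  obtain k where k: "0 \<le> k" "b2 + s *\<^sub>R b1 = k *\<^sub>R r2"
    using h(4) by (auto simp: ray_def)
  have "wd e1 (b2 + s *\<^sub>R b1) = k"
    by (simp add: k(2))
  then have "wd b1 b2 = k"
    by (simp add: b1)
  then have "k = 1"
    using abs_wd_lattice_basis[OF h(3)] k(1) by simp
  have "wd (b2 + s *\<^sub>R b1) e2 = - \<alpha>"
    by (simp add: k(2) \<open>k = 1\<close>) (simp add: r2_def)
  then have s: "- s = \<alpha> + wd b2 e2"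
    by (simp add: b1)
  obtain i where i: "wd b2 e2 = of_int i"
    using wd_Ints[of b2 e2] lattice_basis_in_N[OF h(3)] lattice_basis_in_N[OF basis] Ints_cases
    by blast
  show "T = mod_Z \<alpha>"
    unfolding h(5) s i mod_Z_def
  proof (intro set_eqI iffI)
    fix x assume "x \<in> {\<alpha> + of_int i + of_int k | k :: int. True}"
    then obtain k :: int where "x = \<alpha> + of_int (i + k)" by auto
    then show "x \<in> {\<alpha> + of_int k | k :: int. True}" by blast
  next
    fix x assume "x \<in> {\<alpha> + of_int k | k :: int. True}"
    then obtain k :: int where "x = \<alpha> + of_int i + of_int (k - i)" by auto
    then show "x \<in> {\<alpha> + of_int i + of_int k | k :: int. True}" by blast
  qed
qed

section \<open>The continued fraction expansion of \<open>\<alpha>\<close>\<close>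

lemma expansion_step:
  assumes "alive j"
  shows "D (p j) / D (q j) = 1 / (of_int (wt j) + D (q (Suc j)) / D (p j))"
    and "alive (Suc j) \<Longrightarrow> D (q (Suc j)) / D (p j) = 1 / (of_int (gr j) + D (p (Suc j)) / D (q (Suc j)))"
proof -
  note pos = alive_D[OF assms]
  have "of_int (wt j) + D (q (Suc j)) / D (p j) = D (q j) / D (p j)"
    using pos by (simp add: q_Suc field_simps)
  then show "D (p j) / D (q j) = 1 / (of_int (wt j) + D (q (Suc j)) / D (p j))"
    by simp
  assume a: "alive (Suc j)"
  then have "0 < D (q (Suc j))"
    using pos by (simp add: alive_Suc)
  then have "of_int (gr j) + D (p (Suc j)) / D (q (Suc j)) = D (p j) / D (q (Suc j))"
    by (simp add: p_Suc field_simps)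
  then show "D (q (Suc j)) / D (p j) = 1 / (of_int (gr j) + D (p (Suc j)) / D (q (Suc j)))"
    by simp
qed

text \<open>The start is \<open>\<alpha> = D (p 0) / D (q 0)\<close>, and every division step
  replaces the current tail by a partial quotient and a new tail. The sequences are prescribed only
  where the corresponding ray or bounded edge exists.\<close>

lemma expansion:
  fixes w s :: "nat \<Rightarrow> real"
  assumes w: "\<And>i. alive i \<Longrightarrow> w i = of_int (wt i)" and s: "\<And>i. alive (Suc i) \<Longrightarrow> s i = of_int (gr i)"
    and j: "alive j"
  shows "\<alpha> = foldr (\<lambda>a x. 1 / (a + x)) (map (interleave w s) [0..<2 * j]) (D (p j) / D (q j))"
    and "\<alpha> = foldr (\<lambda>a x. 1 / (a + x)) (map (interleave w s) [0..<Suc (2 * j)]) (D (q (Suc j)) / D (p j))"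
proof -
  have il: "interleave w s (2 * i) = w i" "interleave w s (Suc (2 * i)) = s i" for i
    by (simp_all add: interleave_def)
  have odd: "\<alpha> = foldr (\<lambda>a x. 1 / (a + x)) (map (interleave w s) [0..<Suc (2 * j)]) (D (q (Suc j)) / D (p j))"
    if "alive j" "\<alpha> = foldr (\<lambda>a x. 1 / (a + x)) (map (interleave w s) [0..<2 * j]) (D (p j) / D (q j))" for j
    using that(2) expansion_step(1)[OF that(1)] w[OF that(1)] by (simp add: il)
  show even: "\<alpha> = foldr (\<lambda>a x. 1 / (a + x)) (map (interleave w s) [0..<2 * j]) (D (p j) / D (q j))"
    using j
  proof (induction j)
    case 0
    then show ?case by simp
  next
    case (Suc j)
    then have "alive j" by (simp add: alive_Suc)
    then show ?case
      using odd[of j] Suc.IH expansion_step(2)[OF _ Suc.prems] s[OF Suc.prems] by (simp add: il)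
  qed
  show "\<alpha> = foldr (\<lambda>a x. 1 / (a + x)) (map (interleave w s) [0..<Suc (2 * j)]) (D (q (Suc j)) / D (p j))"
    using odd[OF j even] .
qed

text \<open>With \<open>n\<close> rays there are \<open>n\<close> weights and \<open>n - 1\<close>
  gradients; the tail after the last weight is 0 because the algorithm has stopped.\<close>

lemma finite_expansion:
  fixes w s :: "nat \<Rightarrow> real"
  assumes w: "\<And>i. alive i \<Longrightarrow> w i = of_int (wt i)" and s: "\<And>i. alive (Suc i) \<Longrightarrow> s i = of_int (gr i)"
    and n: "Collect alive = {..<n}"
  shows "cont_frac (map (interleave w s) [0..<2 * n - 1]) = \<alpha>"
proof -
  have "0 < n"
    using alive_0 n by auto
  then obtain j where j: "n = Suc j"
    using gr0_implies_Suc by blast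
  then have "alive j" "\<not> alive (Suc j)"
    using n by (auto simp: set_eq_iff)
  then have "D (q (Suc j)) = 0"
    by (simp add: alive_Suc)
  moreover have "2 * n - 1 = Suc (2 * j)"
    using j by simp
  ultimately show ?thesis
    using expansion(2)[where w = w and s = s, OF w s \<open>alive j\<close>] by (simp only: foldr_cont_frac) simp
qed

text \<open>\<open>\<alpha>\<close> and its convergent are the same continued fraction with tails
  \<open>z\<close> in the unit interval and 0, so the contraction estimate bounds their
  difference.\<close>

lemma infinite_expansion:
  fixes w s :: "nat \<Rightarrow> real"
  assumes w: "\<And>i. w i = of_int (wt i)" and s: "\<And>i. s i = of_int (gr i)"
    and alive: "\<And>j. alive j"
  shows "(\<lambda>n. cont_frac (map (interleave w s) [0..<n])) \<longlonglongrightarrow> \<alpha>"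
proof (rule LIM_zero_cancel, rule Lim_null_comparison)
  show "(\<lambda>n. 2 * (1 / 2 :: real) ^ n) \<longlonglongrightarrow> 0"
    by (intro tendsto_mult_right_zero LIMSEQ_realpow_zero) auto
  have bound: "norm (cont_frac (map (interleave w s) [0..<n]) - \<alpha>) \<le> 2 * (1 / 2) ^ n" for n
  proof -
    have "\<exists>z. 0 \<le> z \<and> z \<le> 1 \<and> \<alpha> = foldr (\<lambda>a x. 1 / (a + x)) (map (interleave w s) [0..<n]) z"
    proof (cases "even n")
      case True
      then obtain j where "n = 2 * j" by blast
      then show ?thesis
        using alive_D[OF alive, of j] expansion(1)[where w = w and s = s, OF w s alive, of j]
        by (intro exI[of _ "D (p j) / D (q j)"]) simp
    next
      case False
      then obtain j where "n = Suc (2 * j)"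
        by (metis oddE Suc_eq_plus1)
      then show ?thesis
        using alive_D[OF alive, of j] expansion(2)[where w = w and s = s, OF w s alive, of j]
        by (intro exI[of _ "D (q (Suc j)) / D (p j)"]) simp
    qed
    then obtain z where z: "0 \<le> z" "z \<le> 1"
      "\<alpha> = foldr (\<lambda>a x. 1 / (a + x)) (map (interleave w s) [0..<n]) z"
      by blast
    have "1 \<le> interleave w s k" for k
      using alive_D(4)[OF alive, of "k div 2"] alive_gr[OF alive, of "k div 2"]
      by (simp add: interleave_def w s)
    then have "\<bar>cont_frac (map (interleave w s) [0..<n]) - \<alpha>\<bar> \<le>
        2 * (1 / 2) ^ length (map (interleave w s) [0..<n]) * \<bar>0 - z\<bar>"
      unfolding foldr_cont_frac by (subst z(3), intro foldr_cont_frac_contraction) (use z in auto)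
    also have "\<dots> \<le> 2 * (1 / 2) ^ n * 1"
      using z by (intro mult_mono) auto
    finally show ?thesis by simp
  qed
  then show "\<forall>\<^sub>F n in sequentially. norm (cont_frac (map (interleave w s) [0..<n]) - \<alpha>) \<le> 2 * (1 / 2) ^ n"
    by simp
qed

section \<open>Listings of the caustic\<close>

lemma alive_initial_segment: "Collect alive = UNIV \<or> (\<exists>n. Collect alive = {..<n})"
proof (cases "\<exists>n. \<not> alive n")
  case True
  define n where "n = (LEAST n. \<not> alive n)"
  have "\<not> alive n" and "alive i" if "i < n" for i
    using LeastI_ex[OF True] not_less_Least[of i "\<lambda>n. \<not> alive n"] that by (auto simp: n_def)
  then have "alive i \<longleftrightarrow> i < n" for i
    using alive_mono[of i n] LeastI_ex[OF True] by (metis n_def not_less)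
  then show ?thesis by auto
qed auto

lemma inj_on_rays: "inj_on (\<lambda>j. open_ray (p j)) (Collect alive)"
  using open_ray_p_eq_iff by (auto intro!: inj_onI)

lemma bij_betw_rays: "bij_betw (\<lambda>j. open_ray (p j)) (Collect alive) (caustic_rays N C)"
  using inj_on_rays by (simp add: bij_betw_def caustic_rays_eq)

lemma finite_caustic_rays_iff: "finite (caustic_rays N C) \<longleftrightarrow> finite (Collect alive)"
  using bij_betw_finite[OF bij_betw_rays] by simp

lemma listing_index:
  "(if finite (caustic_rays N C) then {..<card (caustic_rays N C)} else UNIV) = Collect alive"
proof (cases "Collect alive = UNIV")
  case True
  then show ?thesis
    by (simp add: finite_caustic_rays_iff)
next
  case False
  then obtain n where n: "Collect alive = {..<n}"
    using alive_initial_segment by blast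
  moreover have "card (caustic_rays N C) = card (Collect alive)"
    using bij_betw_same_card[OF bij_betw_rays] by simp
  ultimately show ?thesis
    by (simp add: finite_caustic_rays_iff)
qed

lemma natural_listing_rays:
  "natural_listing (ray e1) (caustic_rays N C) (\<lambda>j. open_ray (p j))"
  unfolding natural_listing_def Let_def listing_index
proof (intro conjI ballI impI)
  show "bij_betw (\<lambda>j. open_ray (p j)) (Collect alive) (caustic_rays N C)"
    by (rule bij_betw_rays)
  fix i j assume "i \<in> Collect alive" "j \<in> Collect alive" "i < j"
  then show "closer_to (ray e1) (open_ray (p i)) (open_ray (p j))"
    using closer_to_iff[of i j] by simp
qed

text \<open>Any listing differs from the listing by \<open>p\<close> by a permutation
  \<open>\<sigma>\<close> of the indices. As \<open>closer_to\<close> reflects the order of the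
  indices, \<open>\<sigma>\<close> is increasing, hence the identity.\<close>

lemma natural_listing_unique:
  assumes "natural_listing (ray e1) (caustic_rays N C) W" "alive i"
  shows "W i = open_ray (p i)"
proof -
  have W: "bij_betw W (Collect alive) (caustic_rays N C)"
    and mono: "\<And>i j. alive i \<Longrightarrow> alive j \<Longrightarrow> i < j \<Longrightarrow> closer_to (ray e1) (W i) (W j)"
    using assms(1) unfolding natural_listing_def Let_def listing_index by auto
  define \<sigma> where "\<sigma> = inv_into (Collect alive) (\<lambda>j. open_ray (p j)) \<circ> W"
  have \<sigma>: "bij_betw \<sigma> (Collect alive) (Collect alive)"
    unfolding \<sigma>_def by (rule bij_betw_trans[OF W bij_betw_inv_into[OF bij_betw_rays]])
  have alive_\<sigma>: "alive (\<sigma> i)" if "alive i" for i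
    using bij_betwE[OF \<sigma>] that by simp
  have W\<sigma>: "W i = open_ray (p (\<sigma> i))" if "alive i" for i
    using bij_betw_inv_into_right[OF bij_betw_rays, of "W i"] bij_betwE[OF W] that by (simp add: \<sigma>_def)
  have "\<sigma> i = i"
  proof (rule order_automorphism_initial_segment[OF \<sigma>])
    fix i j assume ij: "i \<in> Collect alive" "j \<in> Collect alive" "i < j"
    then have "closer_to (ray e1) (open_ray (p (\<sigma> i))) (open_ray (p (\<sigma> j)))"
      using mono[of i j] W\<sigma> by simp
    then show "\<sigma> i < \<sigma> j"
      using closer_to_iff alive_\<sigma> ij by simp
  qed (use assms in simp)
  with W\<sigma> assms(2) show ?thesis by metis
qed

theorem continued_fraction_of_caustic:
  "(\<exists>W. natural_listing (ray e1) (caustic_rays N C) W) \<and>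
    (\<forall>W w s.
      natural_listing (ray e1) (caustic_rays N C) W \<and>
      w = (\<lambda>j. ray_weight N C (W j)) \<and>
      s = (\<lambda>j. length_gradient N C (W j) (W (Suc j))) \<longrightarrow>
      (if finite (caustic_rays N C)
       then tropical_cotangent N (ray e1) (ray r2) =
              mod_Z (cont_frac (map (interleave w s) [0..<2 * card (caustic_rays N C) - 1]))
       else \<exists>x. (\<lambda>n. cont_frac (map (interleave w s) [0..<n])) \<longlonglongrightarrow> x \<and>
              tropical_cotangent N (ray e1) (ray r2) = mod_Z x))"
proof (intro conjI allI impI)
  show "\<exists>W. natural_listing (ray e1) (caustic_rays N C) W"
    using natural_listing_rays by blast
  fix W :: "nat \<Rightarrow> (real^2) set" and w s :: "nat \<Rightarrow> real"
  assume h: "natural_listing (ray e1) (caustic_rays N C) W \<and>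
      w = (\<lambda>j. ray_weight N C (W j)) \<and>
      s = (\<lambda>j. length_gradient N C (W j) (W (Suc j)))"
  have W: "W i = open_ray (p i)" if "alive i" for i
    using natural_listing_unique h that by blast
  have w: "w i = of_int (wt i)" if "alive i" for i
    using h W[OF that] ray_weight_eq[OF that] by simp
  have s: "s i = of_int (gr i)" if "alive (Suc i)" for i
    using h W[OF that] W[of i] length_gradient_eq[OF that] that by (simp add: alive_Suc)
  show "if finite (caustic_rays N C)
     then tropical_cotangent N (ray e1) (ray r2) =
            mod_Z (cont_frac (map (interleave w s) [0..<2 * card (caustic_rays N C) - 1]))
     else \<exists>x. (\<lambda>n. cont_frac (map (interleave w s) [0..<n])) \<longlonglongrightarrow> x \<and>
            tropical_cotangent N (ray e1) (ray r2) = mod_Z x"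
  proof (cases "finite (caustic_rays N C)")
    case True
    then have "Collect alive = {..<card (caustic_rays N C)}"
      using listing_index by simp
    then have "cont_frac (map (interleave w s) [0..<2 * card (caustic_rays N C) - 1]) = \<alpha>"
      using w s by (intro finite_expansion)
    with True show ?thesis
      by (simp add: tropical_cotangent_eq)
  next
    case False
    then have "Collect alive = UNIV"
      using listing_index by simp
    then have alive: "alive j" for j
      by blast
    have "w i = of_int (wt i)" "s i = of_int (gr i)" for i
      using w s alive by blast+
    then have "(\<lambda>n. cont_frac (map (interleave w s) [0..<n])) \<longlonglongrightarrow> \<alpha>"
      using alive by (rule infinite_expansion)
    with False show ?thesis
      using tropical_cotangent_eq by auto
  qed
qed

end

section \<open>Reduction to normal position\<close>

lemma cross2_expand:
  assumes "cross2 u v \<noteq> 0"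
  shows "x = (cross2 x v / cross2 u v) *\<^sub>R u + (cross2 u x / cross2 u v) *\<^sub>R v"
proof -
  have "cross2 u v *\<^sub>R x = cross2 x v *\<^sub>R u + cross2 u x *\<^sub>R v"
    by (simp add: cross2_def vec2_eq_iff algebra_simps)
  then have "(1 / cross2 u v) *\<^sub>R (cross2 u v *\<^sub>R x) =
      (1 / cross2 u v) *\<^sub>R (cross2 x v *\<^sub>R u + cross2 u x *\<^sub>R v)"
    by (rule arg_cong)
  then show ?thesis
    using assms by (simp add: scaleR_add_right)
qed

text \<open>Suppose \<open>a < 0\<close>. If \<open>b \<le> 0\<close>, the cone contains
  \<open>- r1\<close> and is not strictly convex; if \<open>b > 0\<close>, then \<open>r2\<close>
  lies strictly between \<open>r1\<close> and the given point, hence in the interior.\<close>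

lemma cone_coordinate_nonneg:
  fixes C :: "(real^2) set"
  assumes C: "convex_cone C" "C \<inter> uminus ` C = {0}"
    and r: "r1 \<in> C" "r2 \<in> C" "r2 \<in> frontier C" "cross2 r1 r2 \<noteq> 0"
    and x: "a *\<^sub>R r1 + b *\<^sub>R r2 \<in> C"
  shows "0 \<le> a"
proof (rule ccontr)
  assume "\<not> 0 \<le> a"
  then have a: "a < 0" by simp
  have comb: "c *\<^sub>R u + d *\<^sub>R v \<in> C" if "0 \<le> c" "0 \<le> d" "u \<in> C" "v \<in> C" for c d u v
    using C(1) that by (intro convex_cone_add convex_cone_scaleR)
  let ?x = "a *\<^sub>R r1 + b *\<^sub>R r2"
  show False
  proof (cases "b \<le> 0")
    case True
    have "(1 / - a) *\<^sub>R ?x + (- b / - a) *\<^sub>R r2 \<in> C"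
      using True a by (intro comb[OF _ _ x r(2)]) (auto simp: divide_nonpos_neg)
    moreover have "(1 / - a) *\<^sub>R ?x + (- b / - a) *\<^sub>R r2 = - r1"
      using a by (simp add: scaleR_add_right)
    ultimately have "r1 \<in> C \<inter> uminus ` C"
      using r(1) by (auto intro!: image_eqI[of _ _ "- r1"])
    then have "r1 = 0"
      using C(2) by simp
    then show False
      using r(4) by (simp add: cross2_def)
  next
    case False
    have cx: "cross2 r1 ?x = b * cross2 r1 r2"
      by (simp add: cross2_def algebra_simps)
    then have ne: "cross2 r1 ?x \<noteq> 0"
      using r(4) False by simp
    \<comment> \<open>The open sector spanned by \<open>r1\<close> and the given point, described by
      Cramer coordinates.\<close>
    define U where "U = {y. 0 < cross2 y ?x / cross2 r1 ?x \<and> 0 < cross2 r1 y / cross2 r1 ?x}"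
    have "open U"
      unfolding U_def cross2_def
      using ne by (intro open_Collect_conj open_Collect_less continuous_intros) (auto simp: cross2_def)
    moreover have "U \<subseteq> C"
    proof
      fix y assume "y \<in> U"
      then have "(cross2 y ?x / cross2 r1 ?x) *\<^sub>R r1 + (cross2 r1 y / cross2 r1 ?x) *\<^sub>R ?x \<in> C"
        unfolding U_def by (intro comb[OF _ _ r(1) x]) simp_all
      then show "y \<in> C"
        using cross2_expand[OF ne, of y] by simp
    qed
    moreover have "r2 \<in> U"
    proof -
      have "cross2 r2 ?x = - a * cross2 r1 r2"
        by (simp add: cross2_def algebra_simps)
      then have "cross2 r2 ?x / cross2 r1 ?x = - a / b" "cross2 r1 r2 / cross2 r1 ?x = 1 / b"
        using r(4) cx by simp_all
      then show ?thesis
        using a False by (simp add: U_def divide_neg_pos)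
    qed
    ultimately have "r2 \<in> interior C"
      by (meson interior_maximal subsetD)
    with r(3) show False
      by (simp add: frontier_def)
  qed
qed

lemma cone_generated_by_boundary:
  assumes cone: "cone_with_boundary_rays C (ray r1) (ray r2)"
  shows "cross2 r1 r2 \<noteq> 0" "C = {a *\<^sub>R r1 + b *\<^sub>R r2 | a b. 0 \<le> a \<and> 0 \<le> b}"
proof -
  have C: "closed C" "convex_cone C" "C \<inter> uminus ` C = {0}"
    and fr: "frontier C = ray r1 \<union> ray r2"
    and np: "\<not> (\<exists>v. parallel_to v (ray r1) \<and> parallel_to v (ray r2))"
    and nz: "\<exists>r. r \<noteq> 0 \<and> ray r1 = ray r"
    using cone by (auto simp: cone_with_boundary_rays_def)
  have self: "v \<in> ray v" for v
    by (auto simp: ray_def intro!: exI[of _ 1])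
  have "r1 \<noteq> 0"
  proof
    assume "r1 = 0"
    with nz obtain r where "r \<noteq> 0" "ray 0 = ray r" by blast
    then have "r \<in> ray 0" using self by simp
    with \<open>r \<noteq> 0\<close> show False by (simp add: ray_def)
  qed
  show cr: "cross2 r1 r2 \<noteq> 0"
  proof
    assume "cross2 r1 r2 = 0"
    then have "cross2 r2 r1 = 0"
      by (simp add: cross2_def algebra_simps)
    then obtain c where c: "r2 = c *\<^sub>R r1"
      using cross2_eq_0_imp_scaled \<open>r1 \<noteq> 0\<close> by blast
    have "parallel_to r1 (ray r1)" "parallel_to r1 (ray r2)"
      using \<open>r1 \<noteq> 0\<close> by (auto simp: parallel_to_def ray_def c simp flip: scaleR_diff_left)
    with np show False by blast
  qed
  have r: "r1 \<in> C" "r2 \<in> C" "r1 \<in> frontier C" "r2 \<in> frontier C"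
    using frontier_subset_closed[OF C(1)] fr self[of r1] self[of r2] by auto
  show "C = {a *\<^sub>R r1 + b *\<^sub>R r2 | a b. 0 \<le> a \<and> 0 \<le> b}"
  proof
    show "{a *\<^sub>R r1 + b *\<^sub>R r2 | a b. 0 \<le> a \<and> 0 \<le> b} \<subseteq> C"
      using C(2) r by (auto intro!: convex_cone_add convex_cone_scaleR)
    show "C \<subseteq> {a *\<^sub>R r1 + b *\<^sub>R r2 | a b. 0 \<le> a \<and> 0 \<le> b}"
    proof
      fix x assume "x \<in> C"
      obtain a b where x: "x = a *\<^sub>R r1 + b *\<^sub>R r2"
        using cross2_expand[OF cr] by blast
      have "0 \<le> a"
        using cone_coordinate_nonneg[OF C(2,3) r(1,2,4) cr] \<open>x \<in> C\<close> x by blast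
      moreover have "cross2 r2 r1 \<noteq> 0"
        using cr by (simp add: cross2_def algebra_simps)
      then have "0 \<le> b"
        using cone_coordinate_nonneg[OF C(2,3) r(2,1,3), of b a] \<open>x \<in> C\<close> x
        by (simp add: add.commute)
      ultimately show "x \<in> {a *\<^sub>R r1 + b *\<^sub>R r2 | a b. 0 \<le> a \<and> 0 \<le> b}"
        using x by blast
    qed
  qed
qed

lemma ray_scale:
  assumes "0 < c"
  shows "ray (c *\<^sub>R v) = ray v"
proof -
  have sub: "ray (k *\<^sub>R u) \<subseteq> ray u" if "0 < k" for k u
  proof
    fix x assume "x \<in> ray (k *\<^sub>R u)"
    then obtain l where "0 \<le> l" "x = (l * k) *\<^sub>R u"
      by (auto simp: ray_def)
    then show "x \<in> ray u"
      using \<open>0 < k\<close> by (auto simp: ray_def intro!: exI[of _ "l * k"])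
  qed
  have "ray ((1 / c) *\<^sub>R c *\<^sub>R v) \<subseteq> ray (c *\<^sub>R v)"
    using assms by (intro sub) simp
  with sub[OF assms, of v] assms show ?thesis
    by auto
qed

text \<open>Dividing the coordinates of \<open>v\<close> by their gcd gives a primitive vector, and
  the Bezout coefficients supply a second vector with determinant 1.\<close>

lemma lattice_basis_adapted:
  assumes "lattice_basis N b1 b2" "v \<in> N" "v \<noteq> 0"
  obtains e1 e2 and g :: int where "lattice_basis N e1 e2" "0 < g" "v = of_int g *\<^sub>R e1"
proof -
  obtain m n :: int where v: "v = of_int m *\<^sub>R b1 + of_int n *\<^sub>R b2"
    using assms(1,2) by (auto simp: lattice_basis_def)
  define g where "g = gcd m n"
  have "m \<noteq> 0 \<or> n \<noteq> 0"
    using assms(3) v by auto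
  then have g: "0 < g"
    by (simp add: g_def)
  obtain m' n' where mn: "m = g * m'" "n = g * n'"
    using gcd_dvd1[of m n] gcd_dvd2[of m n] unfolding g_def[symmetric] dvd_def by blast
  obtain u w where "u * m + w * n = g"
    using bezout_int[of m n] by (auto simp: g_def)
  then have "g * (u * m' + w * n') = g * 1"
    by (simp add: mn algebra_simps)
  then have uw: "u * m' + w * n' = 1"
    using g by (simp only: mult_cancel_left) simp
  show thesis
  proof
    show "lattice_basis N (of_int m' *\<^sub>R b1 + of_int n' *\<^sub>R b2) (of_int (- w) *\<^sub>R b1 + of_int u *\<^sub>R b2)"
      using uw by (intro lattice_basis_change[OF assms(1), of m' u n' "- w"]) (simp_all add: algebra_simps)
    show "0 < g" by (rule g)
    show "v = of_int g *\<^sub>R (of_int m' *\<^sub>R b1 + of_int n' *\<^sub>R b2)"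
      by (simp add: v mn scaleR_add_right)
  qed
qed

lemma normal_position:
  assumes N: "rank_two_lattice N" and cone: "cone_with_boundary_rays C R1 R2"
    and rational: "rational_slope N R1"
  obtains e1 e2 \<alpha> where "normalized_cone N e1 e2 \<alpha>" "R1 = ray e1" "R2 = ray (normalized_cone.r2 e1 e2 \<alpha>)"
    "C = normalized_cone.C e1 e2 \<alpha>"
proof -
  obtain b1 b2 where b: "lattice_basis N b1 b2"
    using N by (auto simp: rank_two_lattice_def)
  obtain r1 r2 where r: "r1 \<noteq> 0" "R1 = ray r1" "R2 = ray r2"
    using cone by (auto simp: cone_with_boundary_rays_def)
  obtain v where v: "v \<in> N" "v \<noteq> 0" "parallel_to v R1"
    using rational by (auto simp: rational_slope_def)
  have "0 *\<^sub>R r1 \<in> R1" "1 *\<^sub>R r1 \<in> R1"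
    unfolding r ray_def by (blast intro: order_refl zero_le_one)+
  then have "\<exists>c. r1 - 0 = c *\<^sub>R v"
    using v(3) unfolding parallel_to_def scaleR_one scaleR_zero_left by blast
  then obtain c where c: "r1 = c *\<^sub>R v"
    by auto
  obtain e1 e2 and g :: int where e: "lattice_basis N e1 e2" "0 < g" "v = of_int g *\<^sub>R e1"
    using lattice_basis_adapted[OF b v(1,2)] .
  \<comment> \<open>Rational slope gives a lattice vector on the line of \<open>R1\<close> only; the
    sign turns it into the direction of the ray.\<close>
  define \<epsilon> :: int where "\<epsilon> = (if 0 < c then 1 else -1)"
  define f1 where "f1 = of_int \<epsilon> *\<^sub>R e1"
  have f: "lattice_basis N f1 e2"
    by (rule lattice_basis_change[OF e(1), of \<epsilon> 1 0 0]) (simp_all add: f1_def \<epsilon>_def)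
  have "c \<noteq> 0"
    using c r(1) by auto
  then have "r1 = (\<bar>c\<bar> * of_int g) *\<^sub>R f1" "0 < \<bar>c\<bar> * of_int g"
    using e(2) by (auto simp: c e(3) f1_def \<epsilon>_def)
  then have R1: "R1 = ray f1"
    using ray_scale[of "\<bar>c\<bar> * of_int g" f1] r(2) by simp
  have "cross2 f1 r2 \<noteq> 0"
    by (rule cone_generated_by_boundary(1)[OF cone[unfolded R1 r(3)]])
  define y where "y = cross2 f1 r2 / cross2 f1 e2"
  define x where "x = cross2 r2 e2 / cross2 f1 e2"
  have fe: "cross2 f1 e2 \<noteq> 0"
    using f by (simp add: lattice_basis_iff)
  have "y \<noteq> 0"
    using fe \<open>cross2 f1 r2 \<noteq> 0\<close> by (simp add: y_def)
  have r2: "r2 = x *\<^sub>R f1 + y *\<^sub>R e2"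
    unfolding x_def y_def by (rule cross2_expand[OF fe])
  \<comment> \<open>The sign puts the second basis vector on the same side of \<open>R1\<close> as
    \<open>R2\<close>.\<close>
  define \<eta> :: int where "\<eta> = (if 0 < y then 1 else -1)"
  \<comment> \<open>The shear that brings \<open>\<alpha>\<close> into \<open>{0<..1}\<close>. The
    floor plus 1, in place of the ceiling, gives \<open>\<alpha> = 1\<close> and not 0 when the
    quotient is an integer.\<close>
  define k where "k = \<lfloor>x / \<bar>y\<bar>\<rfloor> + 1"
  define f2 where "f2 = of_int k *\<^sub>R f1 + of_int \<eta> *\<^sub>R e2"
  define \<alpha> where "\<alpha> = of_int k - x / \<bar>y\<bar>"
  have basis: "lattice_basis N f1 f2"
    by (rule lattice_basis_change[OF f, of 1 \<eta> 0 k]) (simp_all add: f2_def \<eta>_def)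
  have "0 < \<alpha>" "\<alpha> \<le> 1"
    unfolding \<alpha>_def k_def by linarith+
  then have nc: "normalized_cone N f1 f2 \<alpha>"
    using basis by (simp add: normalized_cone_def)
  interpret nc: normalized_cone N f1 f2 \<alpha>
    by (rule nc)
  have "\<bar>y\<bar> * of_int \<eta> = y" "\<bar>y\<bar> * \<alpha> = \<bar>y\<bar> * of_int k - x"
    using \<open>y \<noteq> 0\<close> by (auto simp: \<eta>_def \<alpha>_def right_diff_distrib)
  moreover have "\<bar>y\<bar> *\<^sub>R nc.r2 = (\<bar>y\<bar> * of_int k - \<bar>y\<bar> * \<alpha>) *\<^sub>R f1 + (\<bar>y\<bar> * of_int \<eta>) *\<^sub>R e2"
    unfolding nc.r2_def by (simp add: f2_def algebra_simps)
  ultimately have "r2 = \<bar>y\<bar> *\<^sub>R nc.r2"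
    by (simp add: r2)
  then have R2: "R2 = ray nc.r2"
    using ray_scale[of "\<bar>y\<bar>" nc.r2] \<open>y \<noteq> 0\<close> r(3) by simp
  moreover have "C = nc.C"
    unfolding nc.C_def by (rule cone_generated_by_boundary(2)[OF cone[unfolded R1 R2]])
  ultimately show thesis
    using that nc R1 by blast
qed

theorem theorem67:
  fixes N C R1 R2 :: "(real^2) set"
  assumes "rank_two_lattice N"
    and "cone_with_boundary_rays C R1 R2"
    and "rational_slope N R1"
  shows "(\<exists>W. natural_listing R1 (caustic_rays N C) W) \<and>
    (\<forall>W w s.
      natural_listing R1 (caustic_rays N C) W \<and>
      w = (\<lambda>j. ray_weight N C (W j)) \<and>
      s = (\<lambda>j. length_gradient N C (W j) (W (Suc j))) \<longrightarrow>
      (if finite (caustic_rays N C)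
       then tropical_cotangent N R1 R2 =
              mod_Z (cont_frac (map (interleave w s) [0..<2 * card (caustic_rays N C) - 1]))
       else \<exists>x. (\<lambda>n. cont_frac (map (interleave w s) [0..<n])) \<longlonglongrightarrow> x \<and>
              tropical_cotangent N R1 R2 = mod_Z x))"
proof -
  obtain e1 e2 \<alpha> where h: "normalized_cone N e1 e2 \<alpha>" "R1 = ray e1"
    "R2 = ray (normalized_cone.r2 e1 e2 \<alpha>)" "C = normalized_cone.C e1 e2 \<alpha>"
    using normal_position[OF assms] .
  show ?thesis
    unfolding h(2-4) by (rule normalized_cone.continued_fraction_of_caustic[OF h(1)])
qed

end
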